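(* There is an implementation of the Longest Processing Time First (LPT) heuristic for the uniform machine scheduling problem with $n$ jobs and $m$ machines that runs in $O((n+m)(\log^2 m+\log n))$ time.
   Context: Uniform machine scheduling problem: we are given $n$ jobs $P_1,\dots,P_n$ with sizes $\ell_1,\dots,\ell_n>0$ and $m$ machines $D_1,\dots,D_m$ with speeds $v_1,\dots,v_m>0$. A valid schedule assigns each job to exactly one machine; the completion time of machine $D_j$ is $\sum_{i: P_i \text{ assigned to } D_j} \ell_i/v_j$, and the makespan is the maximum completion time over all machines. The LPT heuristic: sort the jobs in non-increasing order of size; initialize $T_j=0$ for all $j\in[m]$; then, for each job $P_i$ in this order, choose a machine $D_\alpha$ with $\alpha\in\arg\min_{j\in[m]}\left(T_j+\ell_i/v_j\right)$ (ties broken arbitrarily), assign $P_i$ to $D_\alpha$, and set $T_\alpha\leftarrow T_\alpha+\ell_i/v_\alpha$; finally output the schedule (and its makespan $\max_j T_j$). An implementation of LPT is an algorithm producing exactly this output. Arithmetic operations and comparisons on real numbers are assumed to take constant time. *)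

theory Defs
  imports Complex_Main
begin

text \<open>Jobs are indexed by 0..<n with sizes l i > 0, machines by 0..<m with speeds v j > 0.
  A schedule is a map sigma from jobs to machines.\<close>

definition valid_schedule :: "nat \<Rightarrow> nat \<Rightarrow> (nat \<Rightarrow> nat) \<Rightarrow> bool" where
  "valid_schedule n m \<sigma> \<longleftrightarrow> (\<forall>i<n. \<sigma> i < m)"

definition completion_time ::
  "nat \<Rightarrow> (nat \<Rightarrow> real) \<Rightarrow> (nat \<Rightarrow> real) \<Rightarrow> (nat \<Rightarrow> nat) \<Rightarrow> nat \<Rightarrow> real" where
  "completion_time n l v \<sigma> j = (\<Sum>i\<in>{i. i < n \<and> \<sigma> i = j}. l i / v j)"

definition makespan ::
  "nat \<Rightarrow> nat \<Rightarrow> (nat \<Rightarrow> real) \<Rightarrow> (nat \<Rightarrow> real) \<Rightarrow> (nat \<Rightarrow> nat) \<Rightarrow> real" where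
  "makespan n m l v \<sigma> = Max ((\<lambda>j. completion_time n l v \<sigma> j) ` {..<m})"

text \<open>A run of LPT: a processing order pi (a bijection of {0..<n}) that is
  non-increasing in job size, and at step k the job pi k is put on a machine minimising
  T_j + l/v_j, where T_j is the load accumulated by the jobs pi 0, ..., pi (k-1).
  Ties (in the sort and in the argmin) are broken arbitrarily.\<close>

definition lpt_load ::
  "(nat \<Rightarrow> real) \<Rightarrow> (nat \<Rightarrow> real) \<Rightarrow> (nat \<Rightarrow> nat) \<Rightarrow> (nat \<Rightarrow> nat) \<Rightarrow> nat \<Rightarrow> nat \<Rightarrow> real" where
  "lpt_load l v \<pi> \<sigma> k j = (\<Sum>k'\<in>{k'. k' < k \<and> \<sigma> (\<pi> k') = j}. l (\<pi> k') / v j)"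

definition is_LPT_schedule ::
  "nat \<Rightarrow> nat \<Rightarrow> (nat \<Rightarrow> real) \<Rightarrow> (nat \<Rightarrow> real) \<Rightarrow> (nat \<Rightarrow> nat) \<Rightarrow> bool" where
  "is_LPT_schedule n m l v \<sigma> \<longleftrightarrow>
     valid_schedule n m \<sigma> \<and>
     (\<exists>\<pi>. bij_betw \<pi> {..<n} {..<n} \<and>
          (\<forall>k k'. k \<le> k' \<longrightarrow> k' < n \<longrightarrow> l (\<pi> k') \<le> l (\<pi> k)) \<and>
          (\<forall>k<n. \<forall>j<m.
              lpt_load l v \<pi> \<sigma> k (\<sigma> (\<pi> k)) + l (\<pi> k) / v (\<sigma> (\<pi> k))
              \<le> lpt_load l v \<pi> \<sigma> k j + l (\<pi> k) / v j))"

text \<open>State: an integer memory and a real memory, both indexed by integer addresses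
  (indirect addressing). Integer operations: constants, load, +, -, halving.
  Real operations: integer constants, load, conversion from int, +, -, *, /.
  Comparisons on ints and reals. No floor operation (standard real RAM).
  Every executed command costs one unit; since a program is fixed, this equals
  the usual cost up to a constant factor (expression sizes are bounded).\<close>

record state =
  imem :: "int \<Rightarrow> int"
  rmem :: "int \<Rightarrow> real"

datatype iexp = IConst int | ILoad iexp | IAdd iexp iexp | ISub iexp iexp | IHalf iexp

datatype rexp = RConst int | RLoad iexp | ROfInt iexp
  | RAdd rexp rexp | RSub rexp rexp | RMul rexp rexp | RDiv rexp rexp

datatype bexp = ILess iexp iexp | IEq iexp iexp | RLess rexp rexp | REq rexp rexp
  | BNot bexp | BAnd bexp bexp

datatype com = Skip | IStore iexp iexp | RStore iexp rexp | Seq com com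
  | If bexp com com | While bexp com

fun ieval :: "iexp \<Rightarrow> state \<Rightarrow> int" where
  "ieval (IConst c) s = c"
| "ieval (ILoad a) s = imem s (ieval a s)"
| "ieval (IAdd a b) s = ieval a s + ieval b s"
| "ieval (ISub a b) s = ieval a s - ieval b s"
| "ieval (IHalf a) s = ieval a s div 2"

fun reval :: "rexp \<Rightarrow> state \<Rightarrow> real" where
  "reval (RConst c) s = of_int c"
| "reval (RLoad a) s = rmem s (ieval a s)"
| "reval (ROfInt a) s = of_int (ieval a s)"
| "reval (RAdd a b) s = reval a s + reval b s"
| "reval (RSub a b) s = reval a s - reval b s"
| "reval (RMul a b) s = reval a s * reval b s"
| "reval (RDiv a b) s = reval a s / reval b s"

fun beval :: "bexp \<Rightarrow> state \<Rightarrow> bool" where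
  "beval (ILess a b) s = (ieval a s < ieval b s)"
| "beval (IEq a b) s = (ieval a s = ieval b s)"
| "beval (RLess a b) s = (reval a s < reval b s)"
| "beval (REq a b) s = (reval a s = reval b s)"
| "beval (BNot b) s = (\<not> beval b s)"
| "beval (BAnd a b) s = (beval a s \<and> beval b s)"

inductive exec :: "com \<Rightarrow> state \<Rightarrow> nat \<Rightarrow> state \<Rightarrow> bool" where
  Skip: "exec Skip s 1 s"
| IStore: "exec (IStore a e) s 1 (s\<lparr>imem := (imem s)(ieval a s := ieval e s)\<rparr>)"
| RStore: "exec (RStore a e) s 1 (s\<lparr>rmem := (rmem s)(ieval a s := reval e s)\<rparr>)"
| Seq: "exec c1 s t1 s1 \<Longrightarrow> exec c2 s1 t2 s2 \<Longrightarrow> exec (Seq c1 c2) s (t1 + t2) s2"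
| IfT: "beval b s \<Longrightarrow> exec c1 s t s' \<Longrightarrow> exec (If b c1 c2) s (t + 1) s'"
| IfF: "\<not> beval b s \<Longrightarrow> exec c2 s t s' \<Longrightarrow> exec (If b c1 c2) s (t + 1) s'"
| WhileF: "\<not> beval b s \<Longrightarrow> exec (While b c) s 1 s"
| WhileT: "beval b s \<Longrightarrow> exec c s t1 s1 \<Longrightarrow> exec (While b c) s1 t2 s2 \<Longrightarrow>
           exec (While b c) s (t1 + t2 + 1) s2"

definition init_state :: "nat \<Rightarrow> nat \<Rightarrow> (nat \<Rightarrow> real) \<Rightarrow> (nat \<Rightarrow> real) \<Rightarrow> state" where
  "init_state n m l v =
     \<lparr> imem = (\<lambda>a. if a = -1 then int n else if a = -2 then int m else 0),
       rmem = (\<lambda>a. if 0 \<le> a \<and> a < int n then l (nat a)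
                  else if int n \<le> a \<and> a < int n + int m then v (nat a - n) else 0) \<rparr>"

definition output_schedule :: "state \<Rightarrow> nat \<Rightarrow> nat" where
  "output_schedule s i = nat (imem s (int i))"

definition output_ok :: "nat \<Rightarrow> nat \<Rightarrow> (nat \<Rightarrow> real) \<Rightarrow> (nat \<Rightarrow> real) \<Rightarrow> state \<Rightarrow> bool" where
  "output_ok n m l v s \<longleftrightarrow>
     (\<forall>i<n. 0 \<le> imem s (int i)) \<and>
     is_LPT_schedule n m l v (output_schedule s) \<and>
     rmem s (-1) = makespan n m l v (output_schedule s)"

end

theory Submission
  imports Defs
begin

text \<open>
  If machine \<open>j\<close> has load \<open>T\<^sub>j\<close>, then a job of size \<open>x\<close> would finish there at time
  \<open>T\<^sub>j + x / v\<^sub>j\<close>, a line in \<open>x\<close>. LPT asks for the minimum of \<open>m\<close> lines at decreasing values of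
  \<open>x\<close>, and after each query raises the winning line. A kinetic tournament tree on the machines answers
  these queries: every node stores the winner among its leaves and the largest size at which some
  comparison below it will flip. Going down in \<open>x\<close>, a winner is only ever overtaken by a slower machine.

  To count the flips, call a machine settled at a node if it is not slower than the node's winner
  and finishes no later than every machine below the node that is at least as fast. A flip at a node
  settles a new machine there and unsettles none. Raising the line of machine \<open>j\<close> can unsettle \<open>j\<close>
  only, at its \<open>O(log m)\<close> ancestors. So there are \<open>O((n + m) log m)\<close> flips, and each costs
  \<open>O(log m)\<close>. An ordinary tournament tree delivers the jobs by decreasing size in \<open>O(log n)\<close> each.
\<close>

text \<open>Why raising one line unsettles nobody else: let \<open>a\<close> be settled at a node
  while the load of another machine grows. No competitor of \<open>a\<close> improves, so only the
  comparison with the winner's speed can fail, and then the new winner is strictly faster than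
  \<open>a\<close>. But \<open>a\<close> finishes no later than every machine that is at least as
  fast, hence \<open>a\<close> ties with the new winner. The count therefore depends on ties going
  to the slowest machine. This shapes the development: recomputation breaks ties by speed, flips at
  exactly the next job size are carried out before the query, and \<open>H 1 < y\<close> is required
  strictly whenever a load changes, while the invariant under which the size decreases tolerates
  ties. The two factors log m have different origins: one counts the ancestors at which an
  assignment can unsettle a machine, the other is the path searched and recomputed per flip.\<close>

section \<open>Heap-indexed trees\<close>

text \<open>Node \<open>u\<close> has children \<open>2 u\<close> and \<open>2 u + 1\<close>; with \<open>m\<close> leaves, leaf \<open>j\<close> is node \<open>m + j\<close> and the
  inner nodes are \<open>1, \<dots>, m - 1\<close>.\<close>

function path :: "int \<Rightarrow> int set" where
  "path u = (if u \<le> 0 then {} else insert u (path (u div 2)))"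
  by pat_completeness auto
termination by (relation "measure nat") auto

function blen :: "int \<Rightarrow> nat" where
  "blen u = (if u \<le> 0 then 0 else Suc (blen (u div 2)))"
  by pat_completeness auto
termination by (relation "measure nat") auto

declare path.simps [simp del] blen.simps [simp del]

lemma path_nonpos [simp]: "u \<le> 0 \<Longrightarrow> path u = {}"
  by (simp add: path.simps)

lemma path_pos: "0 < u \<Longrightarrow> path u = insert u (path (u div 2))"
  by (simp add: path.simps)

lemma blen_nonpos [simp]: "u \<le> 0 \<Longrightarrow> blen u = 0"
  by (simp add: blen.simps)

lemma blen_pos: "0 < u \<Longrightarrow> blen u = Suc (blen (u div 2))"
  by (simp add: blen.simps)

lemma path_bounds: "u \<in> path p \<Longrightarrow> 1 \<le> u \<and> u \<le> p"
proof (induction p rule: path.induct)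
  case (1 p)
  then show ?case by (cases "p \<le> 0") (auto simp: path_pos)
qed

lemma path_self: "1 \<le> p \<Longrightarrow> p \<in> path p"
  by (simp add: path_pos)

lemma path_parent: "u \<in> path p \<Longrightarrow> 2 \<le> u \<Longrightarrow> u div 2 \<in> path p"
proof (induction p rule: path.induct)
  case (1 p)
  show ?case
  proof (cases "u = p")
    case True
    then show ?thesis using 1 by (simp add: path_pos path_self)
  next
    case False
    then have "0 < p" "u \<in> path (p div 2)" using 1 by (auto simp: path_pos path.simps[of p] split: if_splits)
    then show ?thesis using 1 by (simp add: path_pos)
  qed
qed

lemma path_child: "u \<in> path p \<Longrightarrow> u \<noteq> p \<Longrightarrow> 2 * u \<in> path p \<or> 2 * u + 1 \<in> path p"
proof (induction p rule: path.induct)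
  case (1 p)
  then have p: "0 < p" "u \<in> path (p div 2)" by (auto simp: path.simps[of p] split: if_splits)
  show ?case
  proof (cases "u = p div 2")
    case True
    then have "p = 2 * u \<or> p = 2 * u + 1" by presburger
    then show ?thesis using p path_self[of p] by auto
  next
    case False
    then show ?thesis using 1 p by (auto simp: path_pos)
  qed
qed

lemma root_in_path: "1 \<le> p \<Longrightarrow> 1 \<in> path p"
proof (induction p rule: path.induct)
  case (1 p)
  then show ?case by (cases "p = 1") (auto simp: path_pos)
qed

lemma finite_path [simp]: "finite (path p)"
  by (rule finite_subset[of _ "{1..p}"]) (auto dest: path_bounds)

lemma card_path: "card (path p) = blen p"
proof (induction p rule: path.induct)
  case (1 p)
  show ?case
  proof (cases "p \<le> 0")
    case False
    then have "p \<notin> path (p div 2)" using path_bounds[of p "p div 2"] by auto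
    then show ?thesis using False 1 by (simp add: path_pos blen_pos)
  qed simp
qed

lemma blen_mono: "u \<le> p \<Longrightarrow> blen u \<le> blen p"
proof (induction p arbitrary: u rule: path.induct)
  case (1 p)
  show ?case
  proof (cases "u \<le> 0")
    case False
    then have "blen (u div 2) \<le> blen (p div 2)" using 1 by simp
    then show ?thesis using False 1 by (simp add: blen_pos)
  qed simp
qed

lemma blen_child: "1 \<le> u \<Longrightarrow> blen (2 * u) = Suc (blen u) \<and> blen (2 * u + 1) = Suc (blen u)"
  by (simp add: blen_pos[of "2*u"] blen_pos[of "2*u+1"])

lemma two_power_blen: "1 \<le> u \<Longrightarrow> 2 ^ blen u \<le> 2 * u"
proof (induction u rule: blen.induct)
  case (1 u)
  show ?case
  proof (cases "u = 1")
    case False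
    then have "(2::int) ^ blen (u div 2) \<le> 2 * (u div 2)" using 1 by simp
    then show ?thesis using 1 by (simp add: blen_pos)
  qed (simp add: blen.simps)
qed

lemma blen_log: assumes "1 \<le> k" shows "real (blen (int k)) \<le> log 2 (real k) + 1"
proof -
  have "real_of_int (2 ^ blen (int k)) \<le> real_of_int (2 * int k)"
    using two_power_blen[of "int k"] assms by (subst of_int_le_iff) simp
  then have "(2::real) ^ blen (int k) \<le> 2 * real k" by simp
  then have "log 2 (2 ^ blen (int k)) \<le> log 2 (2 * real k)"
    using assms by (subst log_le_cancel_iff) auto
  then show ?thesis using assms by (simp add: log_mult log_nat_power)
qed

section \<open>Kinetic tournament trees\<close>

definition finish :: "(int \<Rightarrow> real) \<Rightarrow> (int \<Rightarrow> real) \<Rightarrow> real \<Rightarrow> int \<Rightarrow> real" where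
  "finish T v y j = T j + y / v j"

text \<open>The size below which the loser \<open>b\<close> overtakes the winner \<open>a\<close>. The value 0 stands for never, because
  all job sizes are positive.\<close>

definition cross :: "(int \<Rightarrow> real) \<Rightarrow> (int \<Rightarrow> real) \<Rightarrow> int \<Rightarrow> int \<Rightarrow> real" where
  "cross T v a b = (if v b < v a then (T a - T b) / (1 / v b - 1 / v a) else 0)"

text \<open>The quantified \<open>a\<close> and \<open>b\<close> cover both orientations of the
  comparison. Ties are allowed in favour of either machine, because the condition has to hold down
  to the exact size of a crossing. \<open>H u\<close> takes the maximum over the subtree, so
  \<open>H 1\<close> is the next size at which some comparison flips.\<close>

definition node_ok where
  "node_ok T v y W H u \<longleftrightarrow>
     (\<exists>a b. (a = W (2 * u) \<and> b = W (2 * u + 1) \<or> a = W (2 * u + 1) \<and> b = W (2 * u)) \<and>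
        W u = a \<and> finish T v y a \<le> finish T v y b \<and>
        H u = max (cross T v a b) (max (H (2 * u)) (H (2 * u + 1))))"

text \<open>The state of a node right after recomputation: ties go to the slower machine, which stays ahead
  for all smaller sizes. This makes every pending flip lie strictly below the current size.\<close>

definition pulled where
  "pulled T v y W H u \<longleftrightarrow>
     (\<exists>a b. (a = W (2 * u) \<and> b = W (2 * u + 1) \<or> a = W (2 * u + 1) \<and> b = W (2 * u)) \<and>
        W u = a \<and> (finish T v y a < finish T v y b \<or> finish T v y a = finish T v y b \<and> v a \<le> v b) \<and>
        H u = max (cross T v a b) (max (H (2 * u)) (H (2 * u + 1))))"

definition tree_ok where
  "tree_ok m T v y W H \<longleftrightarrow>
     (\<forall>j\<in>{0..<m}. W (m + j) = j \<and> H (m + j) = 0) \<and> (\<forall>u\<in>{1..<m}. node_ok T v y W H u)"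

lemma pulled_node_ok: "pulled T v y W H u \<Longrightarrow> node_ok T v y W H u"
  unfolding pulled_def node_ok_def by (metis less_eq_real_def)

lemma tree_nodeE:
  assumes "tree_ok m T v y W H" "1 \<le> u" "u < m"
  obtains a b where "a = W (2 * u) \<and> b = W (2 * u + 1) \<or> a = W (2 * u + 1) \<and> b = W (2 * u)"
    "W u = a" "finish T v y a \<le> finish T v y b"
    "H u = max (cross T v a b) (max (H (2 * u)) (H (2 * u + 1)))"
proof -
  have "node_ok T v y W H u" using assms by (simp add: tree_ok_def)
  then show ?thesis using that unfolding node_ok_def by blast
qed

text \<open>Induction from the leaves to the root: indices grow with depth and stay below
  \<open>2 * m\<close>, so \<open>2 * m - u\<close> decreases from a node to its children.\<close>

lemma tree_induct [consumes 2, case_names leaf node]: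
  fixes u m :: int
  assumes "1 \<le> u" "u < 2 * m"
    and leaf: "\<And>j. 0 \<le> j \<Longrightarrow> j < m \<Longrightarrow> P (m + j)"
    and node: "\<And>u. 1 \<le> u \<Longrightarrow> u < m \<Longrightarrow> P (2 * u) \<Longrightarrow> P (2 * u + 1) \<Longrightarrow> P u"
  shows "P u"
  using assms(1,2)
proof (induction "nat (2 * m - u)" arbitrary: u rule: less_induct)
  case less
  show ?case
  proof (cases "u < m")
    case True
    show ?thesis by (rule node) (use less True in auto)
  next
    case False
    then show ?thesis using leaf[of "u - m"] less by auto
  qed
qed

text \<open>The parent of a leaf has index below \<open>m\<close>, so no leaf is a proper ancestor
  of another.\<close>

lemma leaf_path: "m + c \<in> path (m + d) \<Longrightarrow> 0 \<le> c \<Longrightarrow> d < m \<Longrightarrow> c = d"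
  using path_pos[of "m + d"] path_bounds[of "m + c" "(m + d) div 2"] path_bounds[of "m + c" "m + d"]
  by auto

text \<open>The difference of the two lines is increasing in \<open>y\<close> when the loser is
  slower, and \<open>cross\<close> is its only zero.\<close>

lemma cross_eq:
  assumes "0 < v a" "0 < v b" "v b < v a"
  shows "finish T v y a \<le> finish T v y b \<longleftrightarrow> cross T v a b \<le> y"
    and "finish T v y a = finish T v y b \<longleftrightarrow> cross T v a b = y"
proof -
  have d: "0 < 1 / v b - 1 / v a" using assms by (simp add: field_simps)
  have c: "cross T v a b = (T a - T b) / (1 / v b - 1 / v a)" using assms by (simp add: cross_def)
  have e: "finish T v y b - finish T v y a = y * (1 / v b - 1 / v a) - (T a - T b)"
    by (simp add: finish_def algebra_simps)
  have "cross T v a b \<le> y \<longleftrightarrow> T a - T b \<le> y * (1 / v b - 1 / v a)"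
    unfolding c by (rule pos_divide_le_eq[OF d])
  then show "finish T v y a \<le> finish T v y b \<longleftrightarrow> cross T v a b \<le> y"
    using e by linarith
  have "cross T v a b = y \<longleftrightarrow> T a - T b = y * (1 / v b - 1 / v a)"
    unfolding c using d by (subst divide_eq_eq) auto
  then show "finish T v y a = finish T v y b \<longleftrightarrow> cross T v a b = y"
    using e by linarith
qed

text \<open>The line of the slower machine is at least as steep, so a smaller size helps it at least
  as much.\<close>

lemma finish_le_earlier:
  assumes "0 < v a" "v a \<le> v b" "y' \<le> y" "finish T v y a \<le> finish T v y b"
  shows "finish T v y' a \<le> finish T v y' b"
proof -
  have "1 / v b \<le> 1 / v a" using assms by (simp add: frac_le)
  then have "(y - y') * (1 / v b) \<le> (y - y') * (1 / v a)"
    using assms by (intro mult_left_mono) auto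
  then show ?thesis using assms(4) by (simp add: finish_def algebra_simps diff_divide_distrib)
qed

section \<open>Valid trees: winners, ties, and preservation under advancing and recomputing\<close>

locale speeds =
  fixes m :: int and v :: "int \<Rightarrow> real"
  assumes m_pos: "1 \<le> m" and v_pos: "\<And>j. 0 \<le> j \<Longrightarrow> j < m \<Longrightarrow> 0 < v j"
begin

text \<open>\<open>u \<in> path (m + j)\<close> expresses that leaf \<open>j\<close> lies below
  \<open>u\<close>.\<close>

lemma tree_winner:
  assumes "tree_ok m T v y W H" "1 \<le> u" "u < 2 * m"
  shows "0 \<le> W u \<and> W u < m \<and> u \<in> path (m + W u) \<and>
    (\<forall>j. 0 \<le> j \<longrightarrow> j < m \<longrightarrow> u \<in> path (m + j) \<longrightarrow> finish T v y (W u) \<le> finish T v y j)"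
  using assms(2,3)
proof (induction rule: tree_induct)
  case (leaf j)
  then show ?case using assms(1) path_self[of "m + j"] leaf_path[of m j]
    by (auto simp: tree_ok_def)
next
  case (node u)
  obtain a b where ab: "a = W (2 * u) \<and> b = W (2 * u + 1) \<or> a = W (2 * u + 1) \<and> b = W (2 * u)"
    and w: "W u = a" "finish T v y a \<le> finish T v y b"
    and "H u = max (cross T v a b) (max (H (2 * u)) (H (2 * u + 1)))"
    by (rule tree_nodeE[OF assms(1) node(1,2)])
  have 1: "u \<in> path (m + a)"
    using ab node path_parent[of "2*u" "m+a"] path_parent[of "2*u+1" "m+a"] by auto
  have 2: "finish T v y a \<le> finish T v y j" if j: "0 \<le> j" "j < m" "u \<in> path (m + j)" for j
  proof -
    have "2 * u \<in> path (m + j) \<or> 2 * u + 1 \<in> path (m + j)"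
      using path_child[of u "m + j"] j node by auto
    then show ?thesis using ab w node j by fastforce
  qed
  show ?case using 1 2 ab w node by auto
qed

lemma tree_pending_le_root:
  assumes "tree_ok m T v y W H" "1 \<le> u" "u < 2 * m"
  shows "H u \<le> H 1"
  using assms(2,3)
proof (induction "nat u" arbitrary: u rule: less_induct)
  case less
  show ?case
  proof (cases "u = 1")
    case False
    define q where "q = u div 2"
    have q: "1 \<le> q" "q < m" "q < u" "u = 2 * q \<or> u = 2 * q + 1"
      using less False unfolding q_def by auto
    then have "node_ok T v y W H q" using assms(1) by (simp add: tree_ok_def)
    then have "H u \<le> H q" using q(4) by (auto simp: node_ok_def)
    also have "H q \<le> H 1" using less q by auto
    finally show ?thesis .
  qed simp
qed

text \<open>A tie with a slower loser would be a crossing at exactly \<open>y\<close>, which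
  \<open>H 1 < y\<close> rules out. Hence the winner is slowest among all leaves that attain the
  minimum.\<close>

lemma tree_winner_tie:
  assumes ok: "tree_ok m T v y W H" and "H 1 < y" "1 \<le> u" "u < 2 * m"
  shows "\<forall>j. 0 \<le> j \<longrightarrow> j < m \<longrightarrow> u \<in> path (m + j) \<longrightarrow> finish T v y j \<le> finish T v y (W u) \<longrightarrow> v (W u) \<le> v j"
  using assms(3,4)
proof (induction rule: tree_induct)
  case (leaf j)
  then show ?case using assms(1) leaf_path[of m j] by (auto simp: tree_ok_def)
next
  case (node u)
  obtain a b where ab: "a = W (2 * u) \<and> b = W (2 * u + 1) \<or> a = W (2 * u + 1) \<and> b = W (2 * u)"
    and w: "W u = a" "finish T v y a \<le> finish T v y b" and "H u = max (cross T v a b) (max (H (2 * u)) (H (2 * u + 1)))"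
    by (rule tree_nodeE[OF assms(1) node(1,2)])
  then have h: "cross T v a b \<le> H u" by simp
  have win: "0 \<le> W q \<and> W q < m \<and>
      (\<forall>j. 0 \<le> j \<longrightarrow> j < m \<longrightarrow> q \<in> path (m + j) \<longrightarrow> finish T v y (W q) \<le> finish T v y j)"
    if "q = 2 * u \<or> q = 2 * u + 1" for q
    using tree_winner[OF ok, of q] node that by auto
  have av: "0 < v a" "0 < v b" using ab win v_pos by auto
  have "H u < y" using tree_pending_le_root[OF ok, of u] node assms(2) by auto
  then have tie: "v a \<le> v b" if "finish T v y b \<le> finish T v y a"
    using cross_eq(2)[OF av, of T y] that w h by fastforce
  show ?case
  proof (intro allI impI)
    fix j assume j: "0 \<le> j" "j < m" "u \<in> path (m + j)" "finish T v y j \<le> finish T v y (W u)"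
    have c: "2 * u \<in> path (m + j) \<or> 2 * u + 1 \<in> path (m + j)"
      using path_child[of u "m + j"] j node by auto
    have IH: "q \<in> path (m + j) \<Longrightarrow> finish T v y j \<le> finish T v y (W q) \<Longrightarrow> v (W q) \<le> v j"
      if "q = 2 * u \<or> q = 2 * u + 1" for q
      using node that j by auto
    from c ab consider q where "q = 2 * u \<or> q = 2 * u + 1" "q \<in> path (m + j)" "W q = a"
      | q where "q = 2 * u \<or> q = 2 * u + 1" "q \<in> path (m + j)" "W q = b" by metis
    then show "v (W u) \<le> v j"
    proof cases
      case 1
      then show ?thesis using IH[of q] j w by simp
    next
      case 2
      \<comment> \<open>Here \<open>j\<close> lies on the loser's side; the chain from
        \<open>b\<close> to \<open>j\<close> to \<open>a\<close> and back to \<open>b\<close> forces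
        a three-way tie, so the speeds compare through \<open>b\<close>.\<close>
      have "finish T v y b \<le> finish T v y j" using win[of q] 2 j by auto
      then have "finish T v y b \<le> finish T v y a" "finish T v y j \<le> finish T v y b" using j w by auto
      then show ?thesis using IH[of q] 2 tie w by auto
    qed
  qed
qed

text \<open>Down to the largest pending flip nothing changes: a winner facing a slower loser stays
  ahead until their crossing, and a winner that is not faster only gains.\<close>

lemma tree_ok_advance:
  assumes ok: "tree_ok m T v y W H" and "H 1 \<le> y'" "y' \<le> y"
  shows "tree_ok m T v y' W H"
proof -
  have "node_ok T v y' W H u" if u: "1 \<le> u" "u < m" for u
  proof -
    obtain a b where ab: "a = W (2 * u) \<and> b = W (2 * u + 1) \<or> a = W (2 * u + 1) \<and> b = W (2 * u)"
      and w: "W u = a" "finish T v y a \<le> finish T v y b"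
      and h: "H u = max (cross T v a b) (max (H (2 * u)) (H (2 * u + 1)))"
      by (rule tree_nodeE[OF ok u])
    have av: "0 < v a" "0 < v b"
      using ab tree_winner[OF ok, of "2*u"] tree_winner[OF ok, of "2*u+1"] u v_pos by auto
    have "H u \<le> y'" using tree_pending_le_root[OF ok, of u] u assms(2) by auto
    then have "finish T v y' a \<le> finish T v y' b"
      using cross_eq(1)[OF av, of T y'] finish_le_earlier[of v a b y' y T] av w assms(3) h
      by (cases "v b < v a") auto
    then show ?thesis using ab w h unfolding node_ok_def by blast
  qed
  then show ?thesis using ok by (simp add: tree_ok_def)
qed

text \<open>Loads and recomputed path are kept general so that one statement serves a flip (loads
  unchanged, \<open>p\<close> the flipping node), an assignment, and the removal of a job
  (\<open>p\<close> the parent of the changed leaf).\<close>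

lemma tree_ok_repull:
  assumes ok: "tree_ok m T v y W H"
    and T: "\<And>i. 0 \<le> i \<Longrightarrow> i < m \<Longrightarrow> T' i \<noteq> T i \<Longrightarrow> path ((m + i) div 2) \<subseteq> path p"
    and p: "p < m"
    and on: "\<And>q. q \<in> path p \<Longrightarrow> pulled T' v y W' H' q"
    and off: "\<And>q. q \<notin> path p \<Longrightarrow> W' q = W q \<and> H' q = H q"
  shows "tree_ok m T' v y W' H'"
proof -
  have "W' (m + j) = j \<and> H' (m + j) = 0" if "0 \<le> j" "j < m" for j
    using off[of "m + j"] ok that path_bounds[of "m + j" p] p by (auto simp: tree_ok_def)
  moreover have "node_ok T' v y W' H' u" if u: "1 \<le> u" "u < m" for u
  proof (cases "u \<in> path p")
    case False
    then have off': "2 * u \<notin> path p" "2 * u + 1 \<notin> path p"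
      using path_parent[of "2*u" p] path_parent[of "2*u+1" p] u by auto
    \<comment> \<open>A changed winner would have \<open>u\<close> among the ancestors of its leaf,
      and all of these are recomputed.\<close>
    have same: "T' (W q) = T (W q)" if "q = 2 * u \<or> q = 2 * u + 1" for q
    proof (rule ccontr)
      assume ne: "T' (W q) \<noteq> T (W q)"
      have w: "0 \<le> W q" "W q < m" "q \<in> path (m + W q)"
        using tree_winner[OF ok, of q] that u by auto
      then have "u \<in> path (m + W q)" using path_parent[of q "m + W q"] that u by auto
      then have "u \<in> path ((m + W q) div 2)" using path_pos[of "m + W q"] u w by auto
      then show False using T[OF w(1,2) ne] False by auto
    qed
    obtain a b where ab: "a = W (2 * u) \<and> b = W (2 * u + 1) \<or> a = W (2 * u + 1) \<and> b = W (2 * u)"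
      and w: "W u = a" "finish T v y a \<le> finish T v y b"
      and h: "H u = max (cross T v a b) (max (H (2 * u)) (H (2 * u + 1)))"
      by (rule tree_nodeE[OF ok u])
    have "T' a = T a" "T' b = T b" using ab same by auto
    then have "finish T' v y a \<le> finish T' v y b" "cross T' v a b = cross T v a b"
      using w(2) by (simp_all add: finish_def cross_def)
    then show ?thesis
      unfolding node_ok_def
      using ab w(1) h off[OF off'(1)] off[OF off'(2)] off[OF False] by (intro exI[of _ a] exI[of _ b]) simp
  qed (use on pulled_node_ok in blast)
  ultimately show ?thesis by (simp add: tree_ok_def)
qed

text \<open>A crossing at exactly \<open>y\<close> would be a tie with a slower loser, but
  \<open>pulled\<close> gives ties to the slower machine. If the loser is not slower,
  \<open>cross\<close> is 0, and this is where \<open>0 < y\<close> enters.\<close>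

lemma pulled_pending_less:
  assumes ok: "tree_ok m T v y W H" and "0 < y" "1 \<le> u" "u < m" "pulled T v y W H u"
    "H (2 * u) < y" "H (2 * u + 1) < y"
  shows "H u < y"
proof -
  obtain a b where ab: "a = W (2 * u) \<and> b = W (2 * u + 1) \<or> a = W (2 * u + 1) \<and> b = W (2 * u)"
    and w: "finish T v y a < finish T v y b \<or> finish T v y a = finish T v y b \<and> v a \<le> v b"
    and h: "H u = max (cross T v a b) (max (H (2 * u)) (H (2 * u + 1)))"
    using assms(5) unfolding pulled_def by auto
  have av: "0 < v a" "0 < v b"
    using ab tree_winner[OF ok, of "2*u"] tree_winner[OF ok, of "2*u+1"] assms v_pos by auto
  have "cross T v a b < y"
  proof (cases "v b < v a")
    case True
    then show ?thesis using cross_eq[OF av True, of T y] w by auto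
  qed (use assms in \<open>simp add: cross_def\<close>)
  then show ?thesis using h assms by auto
qed

lemma repull_pending_less:
  assumes ok': "tree_ok m T' v y W' H'" and "0 < y"
    and less: "\<And>q. 1 \<le> q \<Longrightarrow> q < 2 * m \<Longrightarrow> H q < y"
    and on: "\<And>q. q \<in> path p \<Longrightarrow> pulled T' v y W' H' q"
    and off: "\<And>q. q \<notin> path p \<Longrightarrow> W' q = W q \<and> H' q = H q"
  shows "H' 1 < y"
proof -
  have "H' u < y" if "1 \<le> u" "u < 2 * m" for u
    using that
  proof (induction rule: tree_induct)
    case (leaf j)
    then show ?case using ok' \<open>0 < y\<close> by (simp add: tree_ok_def)
  next
    case (node u)
    then show ?case
      using pulled_pending_less[OF ok' \<open>0 < y\<close>, of u] on[of u] off[of u] less[of u] by fastforce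
  qed
  then show ?thesis using m_pos by auto
qed

section \<open>Amortised counting of flips\<close>

text \<open>The potential: pairs of a machine and an ancestor at which it is not settled.\<close>

definition bad where
  "bad T y W = {(a, u). 0 \<le> a \<and> a < m \<and> u \<in> path (m + a) \<and>
     \<not> (v (W u) \<le> v a \<and>
        (\<forall>c. 0 \<le> c \<longrightarrow> c < m \<longrightarrow> u \<in> path (m + c) \<longrightarrow> v a \<le> v c \<longrightarrow> finish T v y a \<le> finish T v y c))}"

lemma bad_subset: "bad T y W \<subseteq> Sigma {0..<m} (\<lambda>a. path (m + a))"
  by (auto simp: bad_def)

lemma finite_bad [simp]: "finite (bad T y W)"
  by (rule finite_subset[OF bad_subset]) auto

lemma card_bad: "card (bad T y W) \<le> nat m * blen (2 * m)"
proof -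
  have "card (bad T y W) \<le> card (Sigma {0..<m} (\<lambda>a. path (m + a)))"
    by (rule card_mono[OF _ bad_subset]) auto
  also have "\<dots> = (\<Sum>a\<in>{0..<m}. blen (m + a))" by (simp add: card_path)
  also have "\<dots> \<le> (\<Sum>a\<in>{0..<m}. blen (2 * m))" by (intro sum_mono blen_mono) auto
  finally show ?thesis by simp
qed

text \<open>Being settled compares \<open>a\<close> only with machines at least as fast, and against
  those a smaller size favours \<open>a\<close>.\<close>

lemma bad_advance:
  assumes "y' \<le> y" shows "bad T y' W \<subseteq> bad T y W"
proof (rule subrelI, rule ccontr)
  fix a u assume "(a, u) \<in> bad T y' W" "(a, u) \<notin> bad T y W"
  then show False using finish_le_earlier[of v a _ y' y T] v_pos[of a] assms by (auto simp: bad_def)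
qed

text \<open>Only the requirement \<open>v (W u) \<le> v a\<close> involves the winners, and slower
  winners weaken it, so no pair becomes bad. The pair of \<open>u0\<close> and its new winner leaves
  the set: that machine was slower than the old winner and now attains the minimum.\<close>

lemma bad_event:
  assumes "tree_ok m T v y W' H'" and le: "\<And>u. 1 \<le> u \<Longrightarrow> u < 2 * m \<Longrightarrow> v (W' u) \<le> v (W u)"
    and u0: "1 \<le> u0" "u0 < m" "v (W' u0) < v (W u0)"
  shows "card (bad T y W') < card (bad T y W)"
proof (rule psubset_card_mono)
  have sub: "bad T y W' \<subseteq> bad T y W"
  proof clarify
    fix a u assume b: "(a, u) \<in> bad T y W'"
    then have "1 \<le> u" "u < 2 * m" using path_bounds[of u "m + a"] by (auto simp: bad_def)
    then show "(a, u) \<in> bad T y W" using b le[of u] by (auto simp: bad_def)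
  qed
  have "(W' u0, u0) \<in> bad T y W" "(W' u0, u0) \<notin> bad T y W'"
    using tree_winner[OF assms(1), of u0] u0 by (auto simp: bad_def)
  then show "bad T y W' \<subset> bad T y W" using sub by auto
qed simp

text \<open>All new bad pairs belong to the machine \<open>j\<close> whose load grew, one for each
  ancestor at most. For any other machine the tie rule is decisive.\<close>

lemma bad_update:
  assumes ok': "tree_ok m T' v y W' H'" and "H' 1 < y" and j: "0 \<le> j" "j < m"
    and T: "T j \<le> T' j" "\<And>i. i \<noteq> j \<Longrightarrow> T' i = T i"
    and off: "\<And>q. q \<notin> path (m + j) \<Longrightarrow> W' q = W q"
  shows "card (bad T' y W') \<le> card (bad T y W) + blen (2 * m)"
proof -
  have "bad T' y W' \<subseteq> bad T y W \<union> {j} \<times> path (m + j)"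
  proof (rule subrelI, rule ccontr)
    fix a u assume b: "(a, u) \<in> bad T' y W'" and "(a, u) \<notin> bad T y W \<union> {j} \<times> path (m + j)"
    then have nb: "(a, u) \<notin> bad T y W" and nj: "(a, u) \<notin> {j} \<times> path (m + j)" by auto
    have a: "0 \<le> a" "a < m" "u \<in> path (m + a)" "a \<noteq> j" using b nj by (auto simp: bad_def)
    then have u: "1 \<le> u" "u < 2 * m" using path_bounds[of u "m + a"] by auto
    have f: "finish T v y c \<le> finish T' v y c" for c using T by (cases "c = j") (auto simp: finish_def)
    have fa: "finish T' v y a = finish T v y a" using T a by (simp add: finish_def)
    have g: "v (W u) \<le> v a" and d: "finish T' v y a \<le> finish T' v y c"
      if "0 \<le> c" "c < m" "u \<in> path (m + c)" "v a \<le> v c" for c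
      using nb a f[of c] fa that by (fastforce simp: bad_def)+
    have g: "v (W u) \<le> v a" using g[of a] a by auto
    have lt: "v a < v (W' u)" using b d by (fastforce simp: bad_def)
    have w: "0 \<le> W' u" "W' u < m" "u \<in> path (m + W' u)" using tree_winner[OF ok' u] by auto
    show False
    proof (cases "u \<in> path (m + j)")
      case True
      \<comment> \<open>The faster new winner does not beat \<open>a\<close>, so \<open>a\<close>
        attains the minimum as well, and then the winner cannot be faster than
        \<open>a\<close>.\<close>
      have "finish T' v y a \<le> finish T' v y (W' u)" using d[of "W' u"] w lt by auto
      then have "v (W' u) \<le> v a" using tree_winner_tie[OF ok' assms(2) u] a by auto
      then show False using lt by auto
    qed (use off[of u] lt g in auto)
  qed
  then have "card (bad T' y W') \<le> card (bad T y W \<union> {j} \<times> path (m + j))"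
    by (intro card_mono) auto
  also have "\<dots> \<le> card (bad T y W) + card ({j} \<times> path (m + j))" by (rule card_Un_le)
  also have "\<dots> \<le> card (bad T y W) + blen (2 * m)"
    using blen_mono[of "m + j" "2 * m"] j by (simp add: card_path)
  finally show ?thesis .
qed

text \<open>Since neither child of \<open>u0\<close> has a pending flip at \<open>y\<close>, the
  comparison at \<open>u0\<close> itself is the one that flips. Recomputing its ancestors then
  restores the tree and lowers the potential.\<close>

lemma event_repull:
  assumes ok: "tree_ok m T v y W H" and "0 < y" and u0: "1 \<le> u0" "u0 < m"
    and h: "H u0 = y" "H (2 * u0) \<noteq> y" "H (2 * u0 + 1) \<noteq> y"
    and on: "\<And>q. q \<in> path u0 \<Longrightarrow> pulled T v y W' H' q"
    and off: "\<And>q. q \<notin> path u0 \<Longrightarrow> W' q = W q \<and> H' q = H q"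
  shows "tree_ok m T v y W' H'" "card (bad T y W') < card (bad T y W)"
proof -
  show ok': "tree_ok m T v y W' H'"
    by (rule tree_ok_repull[OF ok _ u0(2) on off]) simp
  \<comment> \<open>The equality of finishing times carries the induction: a recomputed ancestor can
    switch sides only at a tie, and then only to a machine that is not faster.\<close>
  have le: "v (W' u) \<le> v (W u) \<and> finish T v y (W' u) = finish T v y (W u)" if "1 \<le> u" "u < 2 * m" for u
    using that
  proof (induction rule: tree_induct)
    case (leaf j)
    then show ?case using ok ok' by (simp add: tree_ok_def)
  next
    case (node u)
    show ?case
    proof (cases "u \<in> path u0")
      case True
      obtain a b where ab: "a = W (2 * u) \<and> b = W (2 * u + 1) \<or> a = W (2 * u + 1) \<and> b = W (2 * u)"
        and w: "W u = a" "finish T v y a \<le> finish T v y b"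
        and "H u = max (cross T v a b) (max (H (2 * u)) (H (2 * u + 1)))"
        by (rule tree_nodeE[OF ok node(1,2)])
      obtain a' b' where
        "a' = W' (2 * u) \<and> b' = W' (2 * u + 1) \<or> a' = W' (2 * u + 1) \<and> b' = W' (2 * u)"
        "W' u = a'" "finish T v y a' < finish T v y b' \<or> finish T v y a' = finish T v y b' \<and> v a' \<le> v b'"
        using on[OF True] unfolding pulled_def by blast
      then show ?thesis using ab w node(3,4) by (elim disjE conjE) auto
    qed (simp add: off)
  qed
  have "v (W' u0) < v (W u0)"
  proof -
    have c: "2 * u0 \<notin> path u0" "2 * u0 + 1 \<notin> path u0" using path_bounds[of _ u0] u0 by force+
    obtain a b where ab: "a = W (2 * u0) \<and> b = W (2 * u0 + 1) \<or> a = W (2 * u0 + 1) \<and> b = W (2 * u0)"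
      and w: "W u0 = a" "finish T v y a \<le> finish T v y b"
      and hu: "H u0 = max (cross T v a b) (max (H (2 * u0)) (H (2 * u0 + 1)))"
      by (rule tree_nodeE[OF ok u0])
    have av: "0 < v a" "0 < v b"
      using ab tree_winner[OF ok, of "2*u0"] tree_winner[OF ok, of "2*u0+1"] u0 v_pos by auto
    have y: "cross T v a b = y" using h hu by (auto simp: max_def split: if_splits)
    \<comment> \<open>A crossing at a positive size is not the default value 0, so the loser is
      strictly slower.\<close>
    then have lt: "v b < v a" using \<open>0 < y\<close> by (auto simp: cross_def split: if_splits)
    then have "finish T v y a = finish T v y b" using cross_eq(2)[OF av lt] y by simp
    then show ?thesis using on[OF path_self[OF u0(1)]] ab w lt off[OF c(1)] off[OF c(2)]
      unfolding pulled_def by auto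
  qed
  then show "card (bad T y W') < card (bad T y W)"
    using bad_event[OF ok'] le u0 by blast
qed

lemma update_repull:
  assumes ok: "tree_ok m T v y W H" and "0 < y" "H 1 < y" and j: "0 \<le> j" "j < m"
    and T: "T j \<le> T' j" "\<And>i. i \<noteq> j \<Longrightarrow> T' i = T i"
    and on: "\<And>q. q \<in> path ((m + j) div 2) \<Longrightarrow> pulled T' v y W' H' q"
    and off: "\<And>q. q \<notin> path ((m + j) div 2) \<Longrightarrow> W' q = W q \<and> H' q = H q"
  shows "tree_ok m T' v y W' H'" "card (bad T' y W') \<le> card (bad T y W) + blen (2 * m)"
proof -
  show ok': "tree_ok m T' v y W' H'"
    proof (rule tree_ok_repull[OF ok _ _ on off])
    show "path ((m + i) div 2) \<subseteq> path ((m + j) div 2)" if "T' i \<noteq> T i" for i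
      using T(2)[of i] that by (cases "i = j") auto
  qed (use j in auto)
  have "H q < y" if "1 \<le> q" "q < 2 * m" for q
    using tree_pending_le_root[OF ok that] assms(3) by simp
  then have "H' 1 < y" using repull_pending_less[OF ok' \<open>0 < y\<close> _ on off] by blast
  then show "card (bad T' y W') \<le> card (bad T y W) + blen (2 * m)"
    using bad_update[OF ok' _ j T] off path_pos[of "m + j"] j m_pos by auto
qed

end

section \<open>Total correctness with running time\<close>

text \<open>A weakest precondition for total correctness whose postcondition also sees the elapsed
  time, so that programs are executed symbolically by backward rules.\<close>

definition run :: "com \<Rightarrow> state \<Rightarrow> (nat \<Rightarrow> state \<Rightarrow> bool) \<Rightarrow> bool" where
  "run c s Q \<longleftrightarrow> (\<exists>t s'. exec c s t s' \<and> Q t s')"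

lemma run_mono: "run c s Q \<Longrightarrow> (\<And>t s'. Q t s' \<Longrightarrow> Q' t s') \<Longrightarrow> run c s Q'"
  unfolding run_def by blast

lemma run_Skip: "Q 1 s \<Longrightarrow> run Skip s Q"
  unfolding run_def by (blast intro: exec.intros)

lemma run_Seq: "run c1 s (\<lambda>t1 s1. run c2 s1 (\<lambda>t2 s2. Q (t1 + t2) s2)) \<Longrightarrow> run (Seq c1 c2) s Q"
  unfolding run_def by (blast intro: exec.intros)

lemma run_If:
  "(beval b s \<Longrightarrow> run c1 s (\<lambda>t s'. Q (t + 1) s')) \<Longrightarrow>
   (\<not> beval b s \<Longrightarrow> run c2 s (\<lambda>t s'. Q (t + 1) s')) \<Longrightarrow> run (If b c1 c2) s Q"
  unfolding run_def by (cases "beval b s") (blast intro: exec.intros)+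

text \<open>The argument \<open>p\<close> of the invariant is the remaining time budget.\<close>

lemma run_While:
  assumes "I p s"
    and step: "\<And>p s. I p s \<Longrightarrow> beval b s \<Longrightarrow> run c s (\<lambda>t s'. \<exists>p'. I p' s' \<and> t + 1 + p' \<le> p)"
  shows "run (While b c) s (\<lambda>t s'. \<exists>p'. I p' s' \<and> \<not> beval b s' \<and> t + p' \<le> p + 1)"
  using assms(1)
proof (induction p arbitrary: s rule: less_induct)
  case (less p)
  show ?case
  proof (cases "beval b s")
    case True
    then obtain t1 s1 p1 where 1: "exec c s t1 s1" "I p1 s1" "t1 + 1 + p1 \<le> p"
      using step[OF less.prems] unfolding run_def by blast
    then obtain t2 s2 p2 where 2: "exec (While b c) s1 t2 s2" "I p2 s2" "\<not> beval b s2" "t2 + p2 \<le> p1 + 1"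
      using less.IH[of p1 s1] unfolding run_def by auto
    have "exec (While b c) s (t1 + t2 + 1) s2" using True 1 2 by (blast intro: exec.WhileT)
    moreover have "t1 + t2 + 1 + p2 \<le> p + 1" using 1 2 by simp
    ultimately show ?thesis using 2 unfolding run_def by blast
  next
    case False
    then have "exec (While b c) s 1 s" by (rule exec.WhileF)
    then show ?thesis using False less.prems unfolding run_def by (metis add.commute order_refl)
  qed
qed

section \<open>Memory layout\<close>

text \<open>The negative addresses are split into four interleaved arrays 0--3; array 4 consists of the
  nonnegative addresses. The input and output conventions make cell 0 of integer arrays 0 and 1 hold
  \<open>n\<close> and \<open>m\<close>, and cell 0 of real array 0 the makespan. Integer arrays: 0 registers, 2 winners of the machine tree,
  3 winners of the job tree, 4 the schedule. Real arrays: 0 registers (1 the current size \<open>y\<close>, 2 the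
  size \<open>x\<close> of the next job), 1 machine loads, 2 pending flips, 4 the sizes of the remaining jobs
  (0 once scheduled) followed by the speeds.\<close>

definition adr :: "int \<Rightarrow> int \<Rightarrow> int" where
  "adr c k = (if c = 4 then k else - (4 * k + c + 1))"

text \<open>At negative indices the address ranges of array 4 and of the others would overlap.
  Cutting these off to 0 makes the arrays disjoint and lets \<open>arr_upd\<close> be an equation
  between whole functions.\<close>

definition arr :: "int \<Rightarrow> (int \<Rightarrow> 'a::zero) \<Rightarrow> int \<Rightarrow> 'a" where
  "arr c f k = (if 0 \<le> k then f (adr c k) else 0)"

lemma arr_upd [simp]:
  assumes "0 \<le> k" "0 \<le> c" "c \<le> 4" "0 \<le> c'" "c' \<le> 4"
  shows "arr c (f(adr c' k := x)) = (if c = c' then (arr c f)(k := x) else arr c f)"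
  using assms unfolding arr_def adr_def by (auto simp: fun_eq_iff) presburger+

text \<open>Integer expressions have no multiplication, so \<open>4 * k\<close> is built from
  sums.\<close>

definition loc :: "int \<Rightarrow> iexp \<Rightarrow> iexp" where
  "loc c e = (if c = 4 then e else ISub (IConst (- c - 1)) (IAdd (IAdd e e) (IAdd e e)))"

lemma ieval_loc [simp]: "ieval (loc c e) s = adr c (ieval e s)"
  by (simp add: loc_def adr_def)

definition iget :: "int \<Rightarrow> iexp \<Rightarrow> iexp" where "iget c e = ILoad (loc c e)"
definition rget :: "int \<Rightarrow> iexp \<Rightarrow> rexp" where "rget c e = RLoad (loc c e)"
definition iput :: "int \<Rightarrow> iexp \<Rightarrow> iexp \<Rightarrow> com" where "iput c e x = IStore (loc c e) x"
definition rput :: "int \<Rightarrow> iexp \<Rightarrow> rexp \<Rightarrow> com" where "rput c e x = RStore (loc c e) x"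

lemma ieval_iget [simp]: "0 \<le> ieval e s \<Longrightarrow> ieval (iget c e) s = arr c (imem s) (ieval e s)"
  by (simp add: iget_def arr_def)

lemma reval_rget [simp]: "0 \<le> ieval e s \<Longrightarrow> reval (rget c e) s = arr c (rmem s) (ieval e s)"
  by (simp add: rget_def arr_def)

lemma run_iput:
  "Q 1 (s\<lparr>imem := (imem s)(adr c (ieval e s) := ieval x s)\<rparr>) \<Longrightarrow> run (iput c e x) s Q"
  unfolding run_def iput_def using exec.IStore[of "loc c e" x s] by auto

lemma run_rput:
  "Q 1 (s\<lparr>rmem := (rmem s)(adr c (ieval e s) := reval x s)\<rparr>) \<Longrightarrow> run (rput c e x) s Q"
  unfolding run_def rput_def using exec.RStore[of "loc c e" x s] by auto

lemmas run_basic = run_Seq run_iput run_rput run_Skip run_If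

abbreviation reg :: "int \<Rightarrow> iexp" where "reg k \<equiv> iget 0 (IConst k)"
abbreviation setreg :: "int \<Rightarrow> iexp \<Rightarrow> com" where "setreg k \<equiv> iput 0 (IConst k)"
abbreviation "regN \<equiv> reg 0"
abbreviation "regM \<equiv> iget 1 (IConst 0)"
abbreviation "regU \<equiv> reg 1"
abbreviation "regY \<equiv> rget 0 (IConst 1)"
abbreviation "leftU \<equiv> IAdd regU regU"
abbreviation "rightU \<equiv> IAdd (IAdd regU regU) (IConst 1)"
abbreviation bor :: "bexp \<Rightarrow> bexp \<Rightarrow> bexp" where "bor a b \<equiv> BNot (BAnd (BNot a) (BNot b))"

abbreviation speedE :: "iexp \<Rightarrow> rexp" where "speedE j \<equiv> rget 4 (IAdd regN j)"
abbreviation finE :: "iexp \<Rightarrow> rexp" where "finE j \<equiv> RAdd (rget 1 j) (RDiv regY (speedE j))"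
abbreviation crossE :: "iexp \<Rightarrow> iexp \<Rightarrow> rexp" where
  "crossE a b \<equiv> RDiv (RSub (rget 1 a) (rget 1 b))
     (RSub (RDiv (RConst 1) (speedE b)) (RDiv (RConst 1) (speedE a)))"

section \<open>Recomputing tree nodes\<close>

text \<open>Register 5 receives the winner and register 6 the loser, with the tie rule of
  \<open>pulled\<close>.\<close>

definition choose_machine :: com where
  "choose_machine =
     If (bor (RLess (finE (iget 2 leftU)) (finE (iget 2 rightU)))
             (BAnd (REq (finE (iget 2 leftU)) (finE (iget 2 rightU)))
                   (BNot (RLess (speedE (iget 2 rightU)) (speedE (iget 2 leftU))))))
       (Seq (setreg 5 (iget 2 leftU)) (setreg 6 (iget 2 rightU)))
       (Seq (setreg 5 (iget 2 rightU)) (setreg 6 (iget 2 leftU)))"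

definition raise_pending :: "rexp \<Rightarrow> com" where
  "raise_pending e = If (RLess (rget 2 regU) e) (rput 2 regU e) Skip"

definition pull_machine :: com where
  "pull_machine =
     Seq choose_machine (Seq (iput 2 regU (reg 5))
    (Seq (If (RLess (speedE (reg 6)) (speedE (reg 5)))
             (rput 2 regU (crossE (reg 5) (reg 6))) (rput 2 regU (RConst 0)))
    (Seq (raise_pending (rget 2 leftU)) (raise_pending (rget 2 rightU)))))"

definition pull_job :: com where
  "pull_job =
     If (RLess (rget 4 (iget 3 leftU)) (rget 4 (iget 3 rightU)))
       (iput 3 regU (iget 3 rightU)) (iput 3 regU (iget 3 leftU))"

text \<open>Frame condition of node recomputation: only the cursor (register 1), the scratch
  registers 5 and 6, and the two arrays of the machine tree may change.\<close>

definition same_but_machines :: "state \<Rightarrow> state \<Rightarrow> bool" where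
  "same_but_machines s s' \<longleftrightarrow>
     arr 1 (imem s') = arr 1 (imem s) \<and> arr 3 (imem s') = arr 3 (imem s) \<and> arr 4 (imem s') = arr 4 (imem s) \<and>
     (\<forall>k. k \<notin> {1, 5, 6} \<longrightarrow> arr 0 (imem s') k = arr 0 (imem s) k) \<and>
     arr 0 (rmem s') = arr 0 (rmem s) \<and> arr 1 (rmem s') = arr 1 (rmem s) \<and> arr 4 (rmem s') = arr 4 (rmem s)"

definition same_but_jobs :: "state \<Rightarrow> state \<Rightarrow> bool" where
  "same_but_jobs s s' \<longleftrightarrow>
     arr 1 (imem s') = arr 1 (imem s) \<and> arr 2 (imem s') = arr 2 (imem s) \<and> arr 4 (imem s') = arr 4 (imem s) \<and>
     (\<forall>k. k \<noteq> 1 \<longrightarrow> arr 0 (imem s') k = arr 0 (imem s) k) \<and> rmem s' = rmem s"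

lemma run_raise_pending:
  assumes u: "arr 0 (imem s) 1 = u" "0 \<le> u" and x: "reval e s = x"
  shows "run (raise_pending e) s (\<lambda>t s'. t = 2 \<and> imem s' = imem s \<and>
    (\<forall>c\<in>{0,1,3,4}. arr c (rmem s') = arr c (rmem s)) \<and>
    arr 2 (rmem s') = (arr 2 (rmem s))(u := max x (arr 2 (rmem s) u)))"
  unfolding raise_pending_def
  apply (intro run_basic)
  using assms apply (simp_all add: max_def)
  done
text \<open>Equal speeds never cross, so the zero function serves as the pending flips of the job
  tree.\<close>

lemma run_pull_job:
  assumes u: "arr 0 (imem s) 1 = u" "1 \<le> u"
    and J: "0 \<le> arr 3 (imem s) (2 * u)" "0 \<le> arr 3 (imem s) (2 * u + 1)"
  shows "run pull_job s (\<lambda>t s'. t \<le> 2 \<and> same_but_jobs s s' \<and> arr 0 (imem s') 1 = u \<and>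
     (\<forall>q. q \<noteq> u \<longrightarrow> arr 3 (imem s') q = arr 3 (imem s) q) \<and>
     pulled (\<lambda>i. - arr 4 (rmem s') i) (\<lambda>_. 1) 0 (arr 3 (imem s')) (\<lambda>_. 0) u)"
  unfolding pull_job_def
  apply (intro run_basic)
  using assms apply (simp_all add: same_but_jobs_def pulled_def finish_def cross_def)
  by force+

lemma run_choose_machine:
  assumes u: "arr 0 (imem s) 1 = u" "1 \<le> u"
    and W: "0 \<le> arr 2 (imem s) (2 * u)" "0 \<le> arr 2 (imem s) (2 * u + 1)"
    and v: "0 \<le> arr 0 (imem s) 0"
      "v (arr 2 (imem s) (2 * u)) = arr 4 (rmem s) (arr 0 (imem s) 0 + arr 2 (imem s) (2 * u))"
      "v (arr 2 (imem s) (2 * u + 1)) = arr 4 (rmem s) (arr 0 (imem s) 0 + arr 2 (imem s) (2 * u + 1))"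
  shows "run choose_machine s (\<lambda>t s'. t = 3 \<and> (\<exists>a b.
      s' = s\<lparr>imem := (imem s)(adr 0 5 := a, adr 0 6 := b)\<rparr> \<and>
      (a = arr 2 (imem s) (2 * u) \<and> b = arr 2 (imem s) (2 * u + 1) \<or>
       a = arr 2 (imem s) (2 * u + 1) \<and> b = arr 2 (imem s) (2 * u)) \<and>
      (finish (arr 1 (rmem s)) v (arr 0 (rmem s) 1) a < finish (arr 1 (rmem s)) v (arr 0 (rmem s) 1) b \<or>
       finish (arr 1 (rmem s)) v (arr 0 (rmem s) 1) a = finish (arr 1 (rmem s)) v (arr 0 (rmem s) 1) b \<and> v a \<le> v b)))"
proof -
  define L R where "L = arr 2 (imem s) (2 * u)" and "R = arr 2 (imem s) (2 * u + 1)"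
  \<comment> \<open>The second register write reads the tree after register 5 has been overwritten,
    hence the two kinds of states.\<close>
  have g: "ieval (iget 2 leftU) s' = L" "ieval (iget 2 rightU) s' = R"
    if "s' = s \<or> s' = s\<lparr>imem := (imem s)(adr 0 5 := x)\<rparr>" for s' x
    using that u by (auto simp: L_def R_def)
  have f: "reval (finE (iget 2 leftU)) s = finish (arr 1 (rmem s)) v (arr 0 (rmem s) 1) L"
    "reval (finE (iget 2 rightU)) s = finish (arr 1 (rmem s)) v (arr 0 (rmem s) 1) R"
    "reval (speedE (iget 2 leftU)) s = v L" "reval (speedE (iget 2 rightU)) s = v R"
    using v W by (simp_all add: g finish_def flip: L_def R_def)
  show ?thesis
    unfolding choose_machine_def L_def[symmetric] R_def[symmetric]
    apply (intro run_basic)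
    subgoal
      unfolding g[OF disjI1[OF refl]] g[OF disjI2[OF refl]] beval.simps f ieval.simps
      by (rule conjI, simp, rule exI[of _ L], rule exI[of _ R]) auto
    subgoal
      unfolding g[OF disjI1[OF refl]] g[OF disjI2[OF refl]] beval.simps f ieval.simps
      by (rule conjI, simp, rule exI[of _ R], rule exI[of _ L]) auto
    done
qed
text \<open>The bound 10 is 3 for the choice, 1 for storing the winner, and 2 each for the crossing
  and the two maxima.\<close>

lemma run_pull_machine:
  assumes u: "arr 0 (imem s) 1 = u" "1 \<le> u"
    and W: "0 \<le> arr 2 (imem s) (2 * u)" "0 \<le> arr 2 (imem s) (2 * u + 1)"
    and v: "0 \<le> arr 0 (imem s) 0"
      "v (arr 2 (imem s) (2 * u)) = arr 4 (rmem s) (arr 0 (imem s) 0 + arr 2 (imem s) (2 * u))"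
      "v (arr 2 (imem s) (2 * u + 1)) = arr 4 (rmem s) (arr 0 (imem s) 0 + arr 2 (imem s) (2 * u + 1))"
  shows "run pull_machine s (\<lambda>t s'. t \<le> 10 \<and> same_but_machines s s' \<and> arr 0 (imem s') 1 = u \<and>
     (\<forall>q. q \<noteq> u \<longrightarrow> arr 2 (imem s') q = arr 2 (imem s) q \<and> arr 2 (rmem s') q = arr 2 (rmem s) q) \<and>
     pulled (arr 1 (rmem s')) v (arr 0 (rmem s') 1) (arr 2 (imem s')) (arr 2 (rmem s')) u)"
  unfolding pull_machine_def
proof (rule run_Seq, rule run_mono[OF run_choose_machine[OF u W v]],
    goal_cases)
  case (1 t s1)
  then obtain a b where ab: "a = arr 2 (imem s) (2 * u) \<and> b = arr 2 (imem s) (2 * u + 1) \<or>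
       a = arr 2 (imem s) (2 * u + 1) \<and> b = arr 2 (imem s) (2 * u)"
    and t: "t = 3" and s1: "s1 = s\<lparr>imem := (imem s)(adr 0 5 := a, adr 0 6 := b)\<rparr>"
    and f: "finish (arr 1 (rmem s)) v (arr 0 (rmem s) 1) a < finish (arr 1 (rmem s)) v (arr 0 (rmem s) 1) b \<or>
      finish (arr 1 (rmem s)) v (arr 0 (rmem s) 1) a = finish (arr 1 (rmem s)) v (arr 0 (rmem s) 1) b \<and> v a \<le> v b"
    by blast
  have vv: "arr 4 (rmem s) (arr 0 (imem s) 0 + a) = v a" "arr 4 (rmem s) (arr 0 (imem s) 0 + b) = v b" "0 \<le> a" "0 \<le> b"
    using ab v W by auto
  define s2 where "s2 = s1\<lparr>imem := (imem s1)(adr 2 u := a), rmem := (rmem s)(adr 2 u := cross (arr 1 (rmem s)) v a b)\<rparr>"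
  show ?case
    apply (rule run_Seq, rule run_iput, rule run_Seq)
    apply (rule run_mono[where Q = "\<lambda>t s'. t = 2 \<and> s' = s2"])
    subgoal
      apply (intro run_basic)
      using u vv v(1) by (auto simp: s1 s2_def cross_def)
    apply clarify
    apply (rule run_Seq)
    apply (rule run_mono[OF run_raise_pending[where u = u and x = "arr 2 (rmem s) (2 * u)"]])
    subgoal using u by (simp add: s2_def s1)
    subgoal using u by simp
    subgoal using u by (simp add: s2_def s1)
    apply (rule run_mono[OF run_raise_pending[where u = u and x = "arr 2 (rmem s) (2 * u + 1)"]])
    subgoal using u by (simp add: s2_def s1)
    subgoal using u by simp
    subgoal using u by (simp add: s2_def s1)
    subgoal premises prems for _ _ t3 s3 t4 s4
    proof -
      have im: "imem s4 = (imem s)(adr 0 5 := a, adr 0 6 := b, adr 2 u := a)"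
        using prems by (simp add: s2_def s1)
      have rm: "arr c (rmem s4) = arr c (rmem s)" if "c \<in> {0, 1, 3, 4}" for c
        using prems that u by (auto simp: s2_def)
      have H: "arr 2 (rmem s4) = (arr 2 (rmem s))(u := max (arr 2 (rmem s) (2 * u + 1))
          (max (arr 2 (rmem s) (2 * u)) (cross (arr 1 (rmem s)) v a b)))"
        using prems u by (simp add: s2_def)
      have W: "arr 2 (imem s4) = (arr 2 (imem s))(u := a)" using u by (simp add: im)
      have fr: "same_but_machines s s4"
        using u rm by (simp add: same_but_machines_def im)
      have "pulled (arr 1 (rmem s)) v (arr 0 (rmem s) 1) (arr 2 (imem s4)) (arr 2 (rmem s4)) u"
        unfolding pulled_def W H
        by (rule exI[of _ a], rule exI[of _ b]) (use u ab f in \<open>simp add: max.commute max.left_commute\<close>)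
      moreover have "t3 = 2" "t4 = 2" using prems by auto
      moreover have "arr 0 (imem s4) 1 = u" using u by (simp add: im)
      ultimately show ?thesis using fr t rm by (simp add: W H)
    qed
    done
qed

section \<open>Sweeps over tree nodes: climbing to the root and building from scratch\<close>

definition sweep :: "com \<Rightarrow> iexp \<Rightarrow> com" where
  "sweep P e = While (ILess (IConst 0) regU) (Seq P (setreg 1 e))"

text \<open>The cursor visits nodes in decreasing order, and the condition \<open>N\<close> at
  \<open>q\<close> reads only \<open>q\<close>, \<open>2 * q\<close> and \<open>2 * q + 1\<close>,
  so later visits cannot spoil it. \<open>S p\<close> is the set of nodes left when the cursor is at
  \<open>p\<close>, and \<open>L p\<close> their number; each costs \<open>c\<close>, one step for
  moving the cursor and one for the loop test.\<close>

lemma run_sweep: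
  fixes A :: "state \<Rightarrow> int \<Rightarrow> 'x"
  assumes S: "\<And>p. 0 < p \<Longrightarrow> S p = insert p (S (nx p))" "\<And>p. p \<le> 0 \<Longrightarrow> S p = {}" "\<And>p q. q \<in> S p \<Longrightarrow> 1 \<le> q \<and> q \<le> p"
    and nx: "\<And>p. 0 < p \<Longrightarrow> 0 \<le> nx p \<and> nx p < p"
    and L: "\<And>p. 0 < p \<Longrightarrow> L p = Suc (L (nx p))"
    and e: "\<And>s. ieval e s = nx (arr 0 (imem s) 1)"
    and step: "\<And>s p. I s \<Longrightarrow> arr 0 (imem s) 1 = p \<Longrightarrow> p \<in> S u0 \<Longrightarrow>
      run P s (\<lambda>t s'. t \<le> c \<and> I s' \<and> arr 0 (imem s') 1 = p \<and> (\<forall>q. q \<noteq> p \<longrightarrow> A s' q = A s q) \<and> N (A s') p)"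
    and stable: "\<And>s x. I s \<Longrightarrow> I (s\<lparr>imem := (imem s)(adr 0 1 := x)\<rparr>)"
      "\<And>s x. A (s\<lparr>imem := (imem s)(adr 0 1 := x)\<rparr>) = A s"
    and locality: "\<And>f g q. N f q \<Longrightarrow> g q = f q \<Longrightarrow> g (2 * q) = f (2 * q) \<Longrightarrow> g (2 * q + 1) = f (2 * q + 1) \<Longrightarrow> N g q"
    and init: "I s" "arr 0 (imem s) 1 = u0" "0 \<le> u0"
  shows "run (sweep P e) s (\<lambda>t s'. t \<le> (c + 2) * L u0 + 1 \<and> I s' \<and> (\<forall>q\<in>S u0. N (A s') q) \<and>
    (\<forall>q. q \<notin> S u0 \<longrightarrow> A s' q = A s q))"
proof -
  define Inv where "Inv b s' \<longleftrightarrow> (\<exists>p. arr 0 (imem s') 1 = p \<and> 0 \<le> p \<and> S p \<subseteq> S u0 \<and> b = (c + 2) * L p \<and> I s' \<and>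
    (\<forall>q\<in>S u0 - S p. p < q \<and> N (A s') q) \<and> (\<forall>q. q \<notin> S u0 - S p \<longrightarrow> A s' q = A s q))" for b s'
  have "run (sweep P e) s (\<lambda>t s'. \<exists>b. Inv b s' \<and> \<not> beval (ILess (IConst 0) regU) s' \<and> t + b \<le> (c + 2) * L u0 + 1)"
    unfolding sweep_def
  proof (rule run_While)
    show "Inv ((c + 2) * L u0) s" using init by (auto simp: Inv_def)
    fix b s1 assume inv: "Inv b s1" and "beval (ILess (IConst 0) regU) s1"
    then obtain p where p: "arr 0 (imem s1) 1 = p" "0 < p" "S p \<subseteq> S u0" "b = (c + 2) * L p" "I s1"
      and processed: "\<And>q. q \<in> S u0 \<Longrightarrow> q \<notin> S p \<Longrightarrow> p < q \<and> N (A s1) q"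
      and todo: "\<And>q. q \<notin> S u0 - S p \<Longrightarrow> A s1 q = A s q"
      by (auto simp: Inv_def)
    have pS: "p \<in> S u0" using S(1)[OF p(2)] p(3) by auto
    show "run (Seq P (setreg 1 e)) s1 (\<lambda>t s'. \<exists>p'. Inv p' s' \<and> t + 1 + p' \<le> b)"
    proof (rule run_Seq, rule run_mono[OF step[OF p(5,1) pS]], rule run_iput)
      fix t s2 assume st: "t \<le> c \<and> I s2 \<and> arr 0 (imem s2) 1 = p \<and> (\<forall>q. q \<noteq> p \<longrightarrow> A s2 q = A s1 q) \<and> N (A s2) p"
      define s3 where "s3 = s2\<lparr>imem := (imem s2)(adr 0 (ieval (IConst 1) s2) := ieval e s2)\<rparr>"
      have s3: "arr 0 (imem s3) 1 = nx p" "I s3" "A s3 = A s2"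
        using st stable by (simp_all add: s3_def e)
      have pn: "p \<notin> S (nx p)" using S(3)[of p "nx p"] nx[OF p(2)] by auto
      have "Inv ((c + 2) * L (nx p)) s3"
        unfolding Inv_def
      proof (intro exI[of _ "nx p"] conjI ballI allI impI s3)
        show "0 \<le> nx p" using nx[OF p(2)] by simp
        show "S (nx p) \<subseteq> S u0" using S(1)[OF p(2)] p(3) by auto
        fix q assume q: "q \<in> S u0 - S (nx p)"
        then have "q = p \<or> q \<notin> S p" using S(1)[OF p(2)] by auto
        then have "q = p \<or> p < q \<and> N (A s1) q" using processed q by auto
        then show "nx p < q" "N (A s3) q" using nx[OF p(2)] st locality[of "A s1" q "A s2"] p(2) by (auto simp: s3)
      next
        fix q assume "q \<notin> S u0 - S (nx p)"
        then have "q \<notin> S u0 - S p" "q \<noteq> p" using S(1)[OF p(2)] pn pS by auto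
        then show "A s3 q = A s q" using todo st by (simp add: s3)
      qed simp
      moreover have "t + 1 + 1 + (c + 2) * L (nx p) \<le> b" using st p(4) L[OF p(2)] by simp
      ultimately show "\<exists>p'. Inv p' s3 \<and> t + 1 + 1 + p' \<le> b" by blast
    qed
  qed
  then show ?thesis
  proof (rule run_mono)
    fix t s' assume "\<exists>b. Inv b s' \<and> \<not> beval (ILess (IConst 0) regU) s' \<and> t + b \<le> (c + 2) * L u0 + 1"
    then show "t \<le> (c + 2) * L u0 + 1 \<and> I s' \<and> (\<forall>q\<in>S u0. N (A s') q) \<and> (\<forall>q. q \<notin> S u0 \<longrightarrow> A s' q = A s q)"
      using S(2)[of 0] by (auto simp: Inv_def)
  qed
qed

abbreviation "pull_up P \<equiv> sweep P (IHalf regU)"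
abbreviation "build P \<equiv> sweep P (ISub regU (IConst 1))"

definition mem_ok :: "int \<Rightarrow> int \<Rightarrow> (int \<Rightarrow> real) \<Rightarrow> state \<Rightarrow> bool" where
  "mem_ok n m v s \<longleftrightarrow> 0 \<le> n \<and> arr 0 (imem s) 0 = n \<and> arr 1 (imem s) 0 = m \<and>
     (\<forall>j. 0 \<le> j \<longrightarrow> j < m \<longrightarrow> arr 4 (rmem s) (n + j) = v j)"

lemma pulled_local:
  assumes "pulled T v y W H u" "W' u = W u" "W' (2 * u) = W (2 * u)" "W' (2 * u + 1) = W (2 * u + 1)"
    "H' u = H u" "H' (2 * u) = H (2 * u)" "H' (2 * u + 1) = H (2 * u + 1)"
  shows "pulled T v y W' H' u"
  using assms unfolding pulled_def by simp

lemma pulled_cases: "pulled T v y W H u \<Longrightarrow> W u = W (2 * u) \<or> W u = W (2 * u + 1)"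
  unfolding pulled_def by auto

lemma machine_step:
  assumes mem: "mem_ok n m v s0"
    and I: "same_but_machines s0 s \<and> (\<forall>q. 1 \<le> q \<longrightarrow> q < 2 * m \<longrightarrow> 0 \<le> arr 2 (imem s) q \<and> arr 2 (imem s) q < m)"
    and p: "arr 0 (imem s) 1 = p" "1 \<le> p" "p < m"
  shows "run pull_machine s (\<lambda>t s'. t \<le> 10 \<and> (same_but_machines s0 s' \<and>
     (\<forall>q. 1 \<le> q \<longrightarrow> q < 2 * m \<longrightarrow> 0 \<le> arr 2 (imem s') q \<and> arr 2 (imem s') q < m)) \<and> arr 0 (imem s') 1 = p \<and>
     (\<forall>q. q \<noteq> p \<longrightarrow> (arr 2 (imem s') q, arr 2 (rmem s') q) = (arr 2 (imem s) q, arr 2 (rmem s) q)) \<and>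
     pulled (arr 1 (rmem s0)) v (arr 0 (rmem s0) 1) (arr 2 (imem s')) (arr 2 (rmem s')) p)"
proof -
  have w: "0 \<le> arr 2 (imem s) q \<and> arr 2 (imem s) q < m" if "q = 2 * p \<or> q = 2 * p + 1" for q
    using I p that by auto
  have n: "0 \<le> n" "arr 0 (imem s) 0 = n" using mem I by (auto simp: mem_ok_def same_but_machines_def)
  have vq: "v (arr 2 (imem s) q) = arr 4 (rmem s) (arr 0 (imem s) 0 + arr 2 (imem s) q)" if "q = 2 * p \<or> q = 2 * p + 1" for q
    using w[OF that] mem I n by (auto simp: mem_ok_def same_but_machines_def)
  show ?thesis
  proof (rule run_mono[OF run_pull_machine[OF p(1,2), where v = v]])
    fix t s'
    assume a: "t \<le> 10 \<and> same_but_machines s s' \<and> arr 0 (imem s') 1 = p \<and>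
     (\<forall>q. q \<noteq> p \<longrightarrow> arr 2 (imem s') q = arr 2 (imem s) q \<and> arr 2 (rmem s') q = arr 2 (rmem s) q) \<and>
     pulled (arr 1 (rmem s')) v (arr 0 (rmem s') 1) (arr 2 (imem s')) (arr 2 (rmem s')) p"
    have fr: "same_but_machines s0 s'" using a I by (auto simp: same_but_machines_def)
    have "arr 2 (imem s') p = arr 2 (imem s') (2 * p) \<or> arr 2 (imem s') p = arr 2 (imem s') (2 * p + 1)"
      using a pulled_cases[of _ _ _ "arr 2 (imem s')"] by blast
    then have "0 \<le> arr 2 (imem s') p \<and> arr 2 (imem s') p < m"
      using a w[of "2 * p"] w[of "2 * p + 1"] p by auto
    then have "0 \<le> arr 2 (imem s') q \<and> arr 2 (imem s') q < m" if "1 \<le> q" "q < 2 * m" for q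
      using a I that by (cases "q = p") auto
    moreover have "arr 1 (rmem s') = arr 1 (rmem s0)" "arr 0 (rmem s') = arr 0 (rmem s0)"
      using fr by (auto simp: same_but_machines_def)
    ultimately show "t \<le> 10 \<and> (same_but_machines s0 s' \<and>
     (\<forall>q. 1 \<le> q \<longrightarrow> q < 2 * m \<longrightarrow> 0 \<le> arr 2 (imem s') q \<and> arr 2 (imem s') q < m)) \<and> arr 0 (imem s') 1 = p \<and>
     (\<forall>q. q \<noteq> p \<longrightarrow> (arr 2 (imem s') q, arr 2 (rmem s') q) = (arr 2 (imem s) q, arr 2 (rmem s) q)) \<and>
     pulled (arr 1 (rmem s0)) v (arr 0 (rmem s0) 1) (arr 2 (imem s')) (arr 2 (rmem s')) p"
      using a fr by simp
  qed (use n w vq in auto)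
qed

text \<open>The case \<open>u = 0\<close> is needed for a single machine: its leaf is the root, and
  the parent index 0 has an empty path.\<close>

lemma run_pull_up_machine:
  assumes mem: "mem_ok n m v s"
    and W: "\<And>q. 1 \<le> q \<Longrightarrow> q < 2 * m \<Longrightarrow> 0 \<le> arr 2 (imem s) q \<and> arr 2 (imem s) q < m"
    and u: "arr 0 (imem s) 1 = u" "0 \<le> u" "u < m"
  shows "run (pull_up pull_machine) s (\<lambda>t s'. t \<le> 12 * blen u + 1 \<and> same_but_machines s s' \<and>
     (\<forall>q\<in>path u. pulled (arr 1 (rmem s)) v (arr 0 (rmem s) 1) (arr 2 (imem s')) (arr 2 (rmem s')) q) \<and>
     (\<forall>q. q \<notin> path u \<longrightarrow> arr 2 (imem s') q = arr 2 (imem s) q \<and> arr 2 (rmem s') q = arr 2 (rmem s) q))"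
proof (rule run_mono[OF run_sweep[where S = path and nx = "\<lambda>p. p div 2" and L = blen and c = 10
      and A = "\<lambda>s q. (arr 2 (imem s) q, arr 2 (rmem s) q)"
      and N = "\<lambda>f. pulled (arr 1 (rmem s)) v (arr 0 (rmem s) 1) (\<lambda>q. fst (f q)) (\<lambda>q. snd (f q))"
      and I = "\<lambda>s'. same_but_machines s s' \<and> (\<forall>q. 1 \<le> q \<longrightarrow> q < 2 * m \<longrightarrow> 0 \<le> arr 2 (imem s') q \<and> arr 2 (imem s') q < m)"
      and ?u0.0 = u]], goal_cases)
  case (7 s' p)
  then show ?case using machine_step[OF mem, of s' p] path_bounds[of p u] u(3) by simp
next
  case (10 f g q)
  show ?case by (rule pulled_local[OF 10(1)]) (use 10 in simp_all)
next
  case (1 p)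
  then show ?case by (rule path_pos)
next
  case (3 p q)
  then show ?case by (rule path_bounds)
next
  case (5 p)
  then show ?case by (rule blen_pos)
qed (use u W in \<open>simp_all add: same_but_machines_def\<close>)

lemma run_build_machine:
  assumes mem: "mem_ok n m v s"
    and W: "\<And>q. 1 \<le> q \<Longrightarrow> q < 2 * m \<Longrightarrow> 0 \<le> arr 2 (imem s) q \<and> arr 2 (imem s) q < m"
    and u: "arr 0 (imem s) 1 = u" "0 \<le> u" "u < m"
  shows "run (build pull_machine) s (\<lambda>t s'. t \<le> 12 * nat u + 1 \<and> same_but_machines s s' \<and>
     (\<forall>q\<in>{1..u}. pulled (arr 1 (rmem s)) v (arr 0 (rmem s) 1) (arr 2 (imem s')) (arr 2 (rmem s')) q) \<and>
     (\<forall>q. q \<notin> {1..u} \<longrightarrow> arr 2 (imem s') q = arr 2 (imem s) q \<and> arr 2 (rmem s') q = arr 2 (rmem s) q))"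
proof (rule run_mono[OF run_sweep[where S = "\<lambda>p. {1..p}" and nx = "\<lambda>p. p - 1" and L = nat and c = 10
      and A = "\<lambda>s q. (arr 2 (imem s) q, arr 2 (rmem s) q)"
      and N = "\<lambda>f. pulled (arr 1 (rmem s)) v (arr 0 (rmem s) 1) (\<lambda>q. fst (f q)) (\<lambda>q. snd (f q))"
      and I = "\<lambda>s'. same_but_machines s s' \<and> (\<forall>q. 1 \<le> q \<longrightarrow> q < 2 * m \<longrightarrow> 0 \<le> arr 2 (imem s') q \<and> arr 2 (imem s') q < m)"
      and ?u0.0 = u]], goal_cases)
  case (7 s' p)
  then show ?case using machine_step[OF mem, of s' p] u(3) by simp
next
  case (10 f g q)
  show ?case by (rule pulled_local[OF 10(1)]) (use 10 in simp_all)
next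
  case (1 p)
  then show ?case by auto
qed (use u W in \<open>simp_all add: same_but_machines_def\<close>)

lemma job_step:
  assumes I: "same_but_jobs s0 s \<and> (\<forall>q. 1 \<le> q \<longrightarrow> q < 2 * n \<longrightarrow> 0 \<le> arr 3 (imem s) q \<and> arr 3 (imem s) q < n)"
    and p: "arr 0 (imem s) 1 = p" "1 \<le> p" "p < n"
  shows "run pull_job s (\<lambda>t s'. t \<le> 2 \<and> (same_but_jobs s0 s' \<and>
     (\<forall>q. 1 \<le> q \<longrightarrow> q < 2 * n \<longrightarrow> 0 \<le> arr 3 (imem s') q \<and> arr 3 (imem s') q < n)) \<and> arr 0 (imem s') 1 = p \<and>
     (\<forall>q. q \<noteq> p \<longrightarrow> arr 3 (imem s') q = arr 3 (imem s) q) \<and>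
     pulled (\<lambda>i. - arr 4 (rmem s0) i) (\<lambda>_. 1) 0 (arr 3 (imem s')) (\<lambda>_. 0) p)"
proof -
  have w: "0 \<le> arr 3 (imem s) q \<and> arr 3 (imem s) q < n" if "q = 2 * p \<or> q = 2 * p + 1" for q
    using I p that by auto
  show ?thesis
  proof (rule run_mono[OF run_pull_job[OF p(1,2)]])
    fix t s'
    assume a: "t \<le> 2 \<and> same_but_jobs s s' \<and> arr 0 (imem s') 1 = p \<and>
     (\<forall>q. q \<noteq> p \<longrightarrow> arr 3 (imem s') q = arr 3 (imem s) q) \<and>
     pulled (\<lambda>i. - arr 4 (rmem s') i) (\<lambda>_. 1) 0 (arr 3 (imem s')) (\<lambda>_. 0) p"
    have fr: "same_but_jobs s0 s'" using a I by (auto simp: same_but_jobs_def)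
    have "arr 3 (imem s') p = arr 3 (imem s') (2 * p) \<or> arr 3 (imem s') p = arr 3 (imem s') (2 * p + 1)"
      using a pulled_cases[of _ _ _ "arr 3 (imem s')"] by blast
    then have "0 \<le> arr 3 (imem s') p \<and> arr 3 (imem s') p < n"
      using a w[of "2 * p"] w[of "2 * p + 1"] p by auto
    then have "0 \<le> arr 3 (imem s') q \<and> arr 3 (imem s') q < n" if "1 \<le> q" "q < 2 * n" for q
      using a I that by (cases "q = p") auto
    moreover have "rmem s' = rmem s0"
      using fr by (auto simp: same_but_jobs_def)
    ultimately show "t \<le> 2 \<and> (same_but_jobs s0 s' \<and>
     (\<forall>q. 1 \<le> q \<longrightarrow> q < 2 * n \<longrightarrow> 0 \<le> arr 3 (imem s') q \<and> arr 3 (imem s') q < n)) \<and> arr 0 (imem s') 1 = p \<and>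
     (\<forall>q. q \<noteq> p \<longrightarrow> arr 3 (imem s') q = arr 3 (imem s) q) \<and>
     pulled (\<lambda>i. - arr 4 (rmem s0) i) (\<lambda>_. 1) 0 (arr 3 (imem s')) (\<lambda>_. 0) p"
      using a fr by simp
  qed (use w in auto)
qed

lemma run_pull_up_job:
  assumes J: "\<And>q. 1 \<le> q \<Longrightarrow> q < 2 * n \<Longrightarrow> 0 \<le> arr 3 (imem s) q \<and> arr 3 (imem s) q < n"
    and u: "arr 0 (imem s) 1 = u" "0 \<le> u" "u < n"
  shows "run (pull_up pull_job) s (\<lambda>t s'. t \<le> 4 * blen u + 1 \<and> same_but_jobs s s' \<and>
     (\<forall>q\<in>path u. pulled (\<lambda>i. - arr 4 (rmem s) i) (\<lambda>_. 1) 0 (arr 3 (imem s')) (\<lambda>_. 0) q) \<and>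
     (\<forall>q. q \<notin> path u \<longrightarrow> arr 3 (imem s') q = arr 3 (imem s) q))"
proof (rule run_mono[OF run_sweep[where S = path and nx = "\<lambda>p. p div 2" and L = blen and c = 2
      and A = "\<lambda>s. arr 3 (imem s)"
      and N = "\<lambda>f. pulled (\<lambda>i. - arr 4 (rmem s) i) (\<lambda>_. 1) 0 f (\<lambda>_. 0)"
      and I = "\<lambda>s'. same_but_jobs s s' \<and> (\<forall>q. 1 \<le> q \<longrightarrow> q < 2 * n \<longrightarrow> 0 \<le> arr 3 (imem s') q \<and> arr 3 (imem s') q < n)"
      and ?u0.0 = u]], goal_cases)
  case (7 s' p)
  then show ?case using job_step[of s s' n p] path_bounds[of p u] u(3) by simp
next
  case (10 f g q)
  show ?case by (rule pulled_local[OF 10(1)]) (use 10 in simp_all)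
next
  case (1 p)
  then show ?case by (rule path_pos)
next
  case (3 p q)
  then show ?case by (rule path_bounds)
next
  case (5 p)
  then show ?case by (rule blen_pos)
qed (use u J in \<open>simp_all add: same_but_jobs_def\<close>)

lemma run_build_job:
  assumes J: "\<And>q. 1 \<le> q \<Longrightarrow> q < 2 * n \<Longrightarrow> 0 \<le> arr 3 (imem s) q \<and> arr 3 (imem s) q < n"
    and u: "arr 0 (imem s) 1 = u" "0 \<le> u" "u < n"
  shows "run (build pull_job) s (\<lambda>t s'. t \<le> 4 * nat u + 1 \<and> same_but_jobs s s' \<and>
     (\<forall>q\<in>{1..u}. pulled (\<lambda>i. - arr 4 (rmem s) i) (\<lambda>_. 1) 0 (arr 3 (imem s')) (\<lambda>_. 0) q) \<and>
     (\<forall>q. q \<notin> {1..u} \<longrightarrow> arr 3 (imem s') q = arr 3 (imem s) q))"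
proof (rule run_mono[OF run_sweep[where S = "\<lambda>p. {1..p}" and nx = "\<lambda>p. p - 1" and L = nat and c = 2
      and A = "\<lambda>s. arr 3 (imem s)"
      and N = "\<lambda>f. pulled (\<lambda>i. - arr 4 (rmem s) i) (\<lambda>_. 1) 0 f (\<lambda>_. 0)"
      and I = "\<lambda>s'. same_but_jobs s s' \<and> (\<forall>q. 1 \<le> q \<longrightarrow> q < 2 * n \<longrightarrow> 0 \<le> arr 3 (imem s') q \<and> arr 3 (imem s') q < n)"
      and ?u0.0 = u]], goal_cases)
  case (7 s' p)
  then show ?case using job_step[of s s' n p] u(3) by simp
next
  case (10 f g q)
  show ?case by (rule pulled_local[OF 10(1)]) (use 10 in simp_all)
next
  case (1 p)
  then show ?case by auto
qed (use u J in \<open>simp_all add: same_but_jobs_def\<close>)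

abbreviation "regX \<equiv> rget 0 (IConst 2)"
abbreviation "rootPending \<equiv> rget 2 (IConst 1)"

section \<open>Advancing the machine tree to the next job size\<close>

text \<open>Pending values are copied upwards unchanged by maxima, so exact equality with the root's
  value traces the flip down to its source.\<close>

definition descend :: com where
  "descend = While (bor (REq (rget 2 leftU) regY) (REq (rget 2 rightU) regY))
     (If (REq (rget 2 leftU) regY) (setreg 1 leftU) (setreg 1 rightU))"

definition event :: com where
  "event = Seq (rput 0 (IConst 1) rootPending) (Seq (setreg 1 (IConst 1)) (Seq descend (pull_up pull_machine)))"

text \<open>The loop stops only when the root's pending value is strictly below the next size: a
  flip at exactly that size still has to happen, since otherwise a tie could be held by a faster
  machine.\<close>

definition events :: com where
  "events = While (BNot (RLess rootPending regX)) event"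

definition same_but_kinetic :: "state \<Rightarrow> state \<Rightarrow> bool" where
  "same_but_kinetic s s' \<longleftrightarrow>
     arr 1 (imem s') = arr 1 (imem s) \<and> arr 3 (imem s') = arr 3 (imem s) \<and> arr 4 (imem s') = arr 4 (imem s) \<and>
     (\<forall>k. k \<notin> {1, 5, 6} \<longrightarrow> arr 0 (imem s') k = arr 0 (imem s) k) \<and>
     (\<forall>k. k \<noteq> 1 \<longrightarrow> arr 0 (rmem s') k = arr 0 (rmem s) k) \<and>
     arr 1 (rmem s') = arr 1 (rmem s) \<and> arr 4 (rmem s') = arr 4 (rmem s)"

lemma mem_ok_kinetic: "mem_ok n m v s \<Longrightarrow> same_but_kinetic s s' \<Longrightarrow> mem_ok n m v s'"
  by (simp add: mem_ok_def same_but_kinetic_def)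

abbreviation "machine_tree m v s y \<equiv> tree_ok m (arr 1 (rmem s)) v y (arr 2 (imem s)) (arr 2 (rmem s))"

text \<open>Per level, 3 steps for the descent and 12 for the recomputation.\<close>

abbreviation "event_cost m \<equiv> 15 * blen (2 * m) + 5"

context speeds
begin

text \<open>A winner that is not behind has its crossing with a slower loser at or below the current
  size, so the next flip never lies above \<open>y\<close>.\<close>

lemma tree_pending_le:
  assumes ok: "tree_ok m T v y W H" and "0 \<le> y" "1 \<le> u" "u < 2 * m"
  shows "H u \<le> y"
  using assms(3,4)
proof (induction rule: tree_induct)
  case (leaf j)
  then show ?case using assms by (simp add: tree_ok_def)
next
  case (node u)
  obtain a b where ab: "a = W (2 * u) \<and> b = W (2 * u + 1) \<or> a = W (2 * u + 1) \<and> b = W (2 * u)"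
    and w: "W u = a" "finish T v y a \<le> finish T v y b"
    and h: "H u = max (cross T v a b) (max (H (2 * u)) (H (2 * u + 1)))"
    by (rule tree_nodeE[OF ok node(1,2)])
  have av: "0 < v a" "0 < v b"
    using ab tree_winner[OF ok, of "2*u"] tree_winner[OF ok, of "2*u+1"] node v_pos by auto
  have "cross T v a b \<le> y"
  proof (cases "v b < v a")
    case True
    then show ?thesis using cross_eq(1)[OF av True, of T y] w by simp
  qed (use assms in \<open>simp add: cross_def\<close>)
  then show ?case using h node by simp
qed

lemma run_descend:
  assumes ok: "machine_tree m v s y" and y: "arr 0 (rmem s) 1 = y" "0 < y" "arr 2 (rmem s) 1 = y"
    and u: "arr 0 (imem s) 1 = 1"
  shows "run descend s (\<lambda>t s'. t \<le> 3 * blen (2 * m) + 1 \<and> (\<exists>u. s' = s\<lparr>imem := (imem s)(adr 0 1 := u)\<rparr> \<and>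
     1 \<le> u \<and> u < m \<and> arr 2 (rmem s) u = y \<and> arr 2 (rmem s) (2 * u) \<noteq> y \<and> arr 2 (rmem s) (2 * u + 1) \<noteq> y))"
proof -
  let ?H = "arr 2 (rmem s)"
  define Inv where "Inv b s' \<longleftrightarrow> (\<exists>u. s' = s\<lparr>imem := (imem s)(adr 0 1 := u)\<rparr> \<and> 1 \<le> u \<and> u < m \<and> ?H u = y \<and>
     b = 3 * (blen (2 * m) - blen u))" for b s'
  \<comment> \<open>Leaves have pending value 0, so a positive target keeps the descent on inner
    nodes.\<close>
  have internal: "u < m" if "1 \<le> u" "u < 2 * m" "?H u = y" for u
  proof (rule ccontr)
    assume "\<not> u < m"
    then have "?H (m + (u - m)) = 0" using ok that unfolding tree_ok_def by (metis atLeastLessThan_iff diff_ge_0_iff_ge diff_less_eq linorder_not_less mult_2)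
    then show False using that y by simp
  qed
  have "run descend s (\<lambda>t s'. \<exists>b. Inv b s' \<and>
      \<not> beval (bor (REq (rget 2 leftU) regY) (REq (rget 2 rightU) regY)) s' \<and> t + b \<le> 3 * (blen (2 * m) - blen 1) + 1)"
    unfolding descend_def
  proof (rule run_While)
    have "imem s (adr 0 1) = 1" using u by (simp add: arr_def)
    then have "s = s\<lparr>imem := (imem s)(adr 0 1 := 1)\<rparr>" by (simp add: fun_upd_idem)
    then show "Inv (3 * (blen (2 * m) - blen 1)) s"
      unfolding Inv_def using internal[of 1] m_pos y by (intro exI[of _ 1]) auto
  next
    fix b s1 assume "Inv b s1" and beval: "beval (bor (REq (rget 2 leftU) regY) (REq (rget 2 rightU) regY)) s1"
    then obtain u where s1: "s1 = s\<lparr>imem := (imem s)(adr 0 1 := u)\<rparr>" and u: "1 \<le> u" "u < m" "?H u = y"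
      and b: "b = 3 * (blen (2 * m) - blen u)" unfolding Inv_def by blast
    have "?H (2 * u) = y \<or> ?H (2 * u + 1) = y" using beval u y by (auto simp: s1)
    then obtain q where q: "q = 2 * u \<or> q = 2 * u + 1" "?H q = y"
      "q = (if ?H (2 * u) = y then 2 * u else 2 * u + 1)" by metis
    have "blen q = Suc (blen u)" using q blen_child[of u] u by auto
    moreover have "q < 2 * m" using q u by auto
    ultimately have "3 + 3 * (blen (2 * m) - blen q) \<le> b" "Inv (3 * (blen (2 * m) - blen q)) (s\<lparr>imem := (imem s)(adr 0 1 := q)\<rparr>)"
      using b blen_mono[of q "2 * m"] internal[of q] q u unfolding Inv_def by auto
    then have finish: "\<exists>p'. Inv p' (s\<lparr>imem := (imem s)(adr 0 1 := q)\<rparr>) \<and> Suc (Suc (Suc p')) \<le> b" by auto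
    show "run (If (REq (rget 2 leftU) regY) (setreg 1 leftU) (setreg 1 rightU)) s1
       (\<lambda>t s'. \<exists>p'. Inv p' s' \<and> t + 1 + p' \<le> b)"
      apply (intro run_basic)
      using finish q(3) u y by (simp_all add: s1)
  qed
  then show ?thesis
  proof (rule run_mono)
    fix t s' assume "\<exists>b. Inv b s' \<and>
      \<not> beval (bor (REq (rget 2 leftU) regY) (REq (rget 2 rightU) regY)) s' \<and> t + b \<le> 3 * (blen (2 * m) - blen 1) + 1"
    then obtain u where u: "s' = s\<lparr>imem := (imem s)(adr 0 1 := u)\<rparr>" "1 \<le> u" "u < m" "?H u = y"
      and e: "\<not> beval (bor (REq (rget 2 leftU) regY) (REq (rget 2 rightU) regY)) s'" "t \<le> 3 * (blen (2 * m) - blen 1) + 1"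
      unfolding Inv_def by auto
    have "?H (2 * u) \<noteq> y \<and> ?H (2 * u + 1) \<noteq> y" using e(1) u y by simp
    then show "t \<le> 3 * blen (2 * m) + 1 \<and> (\<exists>u. s' = s\<lparr>imem := (imem s)(adr 0 1 := u)\<rparr> \<and>
     1 \<le> u \<and> u < m \<and> ?H u = y \<and> ?H (2 * u) \<noteq> y \<and> ?H (2 * u + 1) \<noteq> y)"
      using u e(2) by fastforce
  qed
qed

lemma run_event:
  assumes mem: "mem_ok n m v s" and ok: "machine_tree m v s y"
    and h: "h = arr 2 (rmem s) 1" "0 < h" "h \<le> y"
  shows "run event s (\<lambda>t s'. t \<le> event_cost m \<and> same_but_kinetic s s' \<and> arr 0 (rmem s') 1 = h \<and>
     machine_tree m v s' h \<and>
     card (bad (arr 1 (rmem s')) h (arr 2 (imem s'))) < card (bad (arr 1 (rmem s)) y (arr 2 (imem s))))"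
proof -
  let ?T = "arr 1 (rmem s)" and ?W = "arr 2 (imem s)" and ?H = "arr 2 (rmem s)"
  define s1 where "s1 = s\<lparr>rmem := (rmem s)(adr 0 1 := h), imem := (imem s)(adr 0 1 := 1)\<rparr>"
  have okh: "machine_tree m v s h" using tree_ok_advance[OF ok] h by simp
  have s1: "arr 1 (rmem s1) = ?T" "arr 2 (imem s1) = ?W" "arr 2 (rmem s1) = ?H" "arr 0 (rmem s1) 1 = h"
    "arr 0 (imem s1) 1 = 1" "same_but_kinetic s s1"
    by (simp_all add: s1_def same_but_kinetic_def)
  have desc: "run descend s1 (\<lambda>t s'. t \<le> 3 * blen (2 * m) + 1 \<and> (\<exists>u. s' = s1\<lparr>imem := (imem s1)(adr 0 1 := u)\<rparr> \<and>
     1 \<le> u \<and> u < m \<and> ?H u = h \<and> ?H (2 * u) \<noteq> h \<and> ?H (2 * u + 1) \<noteq> h))"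
    using run_descend[of s1 h] okh h s1 by simp
  have pull: "run (pull_up pull_machine) s2 (\<lambda>t2 s'. t1 + t2 \<le> event_cost m - 2 \<and> same_but_kinetic s s' \<and> arr 0 (rmem s') 1 = h \<and>
     machine_tree m v s' h \<and>
     card (bad (arr 1 (rmem s')) h (arr 2 (imem s'))) < card (bad ?T y ?W))"
    if t1: "t1 \<le> 3 * blen (2 * m) + 1" and s2: "s2 = s1\<lparr>imem := (imem s1)(adr 0 1 := u)\<rparr>"
      and u: "1 \<le> u" "u < m" "?H u = h" "?H (2 * u) \<noteq> h" "?H (2 * u + 1) \<noteq> h" for t1 s2 u
  proof -
    have s2': "arr 1 (rmem s2) = ?T" "arr 2 (imem s2) = ?W" "arr 2 (rmem s2) = ?H" "arr 0 (rmem s2) 1 = h"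
      "arr 0 (imem s2) 1 = u" "same_but_kinetic s s2"
      using s1 by (simp_all add: s2 same_but_kinetic_def)
    show ?thesis
    proof (rule run_mono[OF run_pull_up_machine[OF mem_ok_kinetic[OF mem s2'(6)], of u]])
      fix t2 s'
      assume a: "t2 \<le> 12 * blen u + 1 \<and> same_but_machines s2 s' \<and>
       (\<forall>q\<in>path u. pulled (arr 1 (rmem s2)) v (arr 0 (rmem s2) 1) (arr 2 (imem s')) (arr 2 (rmem s')) q) \<and>
       (\<forall>q. q \<notin> path u \<longrightarrow> arr 2 (imem s') q = arr 2 (imem s2) q \<and> arr 2 (rmem s') q = arr 2 (rmem s2) q)"
      have T: "arr 1 (rmem s') = ?T" using a s2' by (simp add: same_but_machines_def)
      have on: "\<And>q. q \<in> path u \<Longrightarrow> pulled ?T v h (arr 2 (imem s')) (arr 2 (rmem s')) q"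
        and off: "\<And>q. q \<notin> path u \<Longrightarrow> arr 2 (imem s') q = ?W q \<and> arr 2 (rmem s') q = ?H q"
        using a s2' by simp_all
      note r = event_repull[OF okh h(2) u on off]
      have "card (bad ?T h ?W) \<le> card (bad ?T y ?W)" by (intro card_mono bad_advance h) simp
      moreover have "blen u \<le> blen (2 * m)" using blen_mono u by simp
      moreover have "same_but_kinetic s s' \<and> arr 0 (rmem s') 1 = h"
        using a s2' by (auto simp: same_but_machines_def same_but_kinetic_def)
      ultimately show "t1 + t2 \<le> event_cost m - 2 \<and> same_but_kinetic s s' \<and> arr 0 (rmem s') 1 = h \<and>
         machine_tree m v s' h \<and> card (bad (arr 1 (rmem s')) h (arr 2 (imem s'))) < card (bad ?T y ?W)"
        using r a t1 by (simp add: T)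
    qed (use u s2' tree_winner[OF ok] in auto)
  qed
  show ?thesis
    unfolding event_def
    apply (rule run_Seq, rule run_rput, rule run_Seq, rule run_iput, rule run_Seq)
    apply (rule run_mono[where Q = "\<lambda>t s'. t \<le> 3 * blen (2 * m) + 1 \<and> (\<exists>u. s' = s1\<lparr>imem := (imem s1)(adr 0 1 := u)\<rparr> \<and>
     1 \<le> u \<and> u < m \<and> ?H u = h \<and> ?H (2 * u) \<noteq> h \<and> ?H (2 * u + 1) \<noteq> h)"])
    subgoal using desc by (simp add: s1_def h)
    subgoal for t s2
      apply (elim conjE exE)
      subgoal for u
        apply (rule run_mono[OF pull[of t s2 u]])
        by auto
      done
    done
qed

text \<open>Every flip removes at least one bad pair, so the number of bad pairs times the cost of a
  flip with its loop test is a time budget. In the proof \<open>y'\<close> is the size of the last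
  flip carried out, or \<open>y\<close> if there was none.\<close>

lemma run_events:
  assumes mem: "mem_ok n m v s" and ok: "machine_tree m v s y"
    and y: "arr 0 (rmem s) 1 = y" and x: "arr 0 (rmem s) 2 = x" "0 < x" "x \<le> y"
  shows "run events s (\<lambda>t s'. same_but_kinetic s s' \<and> (\<exists>y'\<ge>x. machine_tree m v s' y' \<and> arr 2 (rmem s') 1 < x \<and>
     t + card (bad (arr 1 (rmem s')) y' (arr 2 (imem s'))) * (event_cost m + 1) \<le>
     card (bad (arr 1 (rmem s)) y (arr 2 (imem s))) * (event_cost m + 1) + 1))"
proof -
  define B :: "real \<Rightarrow> state \<Rightarrow> nat" where "B y s' = card (bad (arr 1 (rmem s')) y (arr 2 (imem s')))" for y s'
  define Inv where "Inv b s' \<longleftrightarrow> same_but_kinetic s s' \<and> (\<exists>y'. x \<le> y' \<and> arr 0 (rmem s') 1 = y' \<and>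
     machine_tree m v s' y' \<and> b = B y' s' * (event_cost m + 1))" for b s'
  have "run events s (\<lambda>t s'. \<exists>b. Inv b s' \<and> \<not> beval (BNot (RLess rootPending regX)) s' \<and>
    t + b \<le> B y s * (event_cost m + 1) + 1)"
    unfolding events_def
  proof (rule run_While)
    show "Inv (B y s * (event_cost m + 1)) s"
      unfolding Inv_def using assms by (auto simp: same_but_kinetic_def)
    fix b s1 assume "Inv b s1" and bev: "beval (BNot (RLess rootPending regX)) s1"
    then obtain y1 where s1: "same_but_kinetic s s1" "x \<le> y1" "arr 0 (rmem s1) 1 = y1"
     "machine_tree m v s1 y1" "b = B y1 s1 * (event_cost m + 1)" unfolding Inv_def by blast
    have "x \<le> arr 2 (rmem s1) 1" using bev x s1(1) by (simp add: same_but_kinetic_def)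
    moreover have "arr 2 (rmem s1) 1 \<le> y1" using tree_pending_le[OF s1(4), of 1] s1 x m_pos by simp
    ultimately have h: "0 < arr 2 (rmem s1) 1" "x \<le> arr 2 (rmem s1) 1" "arr 2 (rmem s1) 1 \<le> y1" using x by auto
    show "run event s1 (\<lambda>t s'. \<exists>p'. Inv p' s' \<and> t + 1 + p' \<le> b)"
    proof (rule run_mono[OF run_event[OF mem_ok_kinetic[OF mem s1(1)] s1(4) refl h(1,3)]])
      fix t s'
      assume a: "t \<le> event_cost m \<and> same_but_kinetic s1 s' \<and> arr 0 (rmem s') 1 = arr 2 (rmem s1) 1 \<and>
         machine_tree m v s' (arr 2 (rmem s1) 1) \<and>
         card (bad (arr 1 (rmem s')) (arr 2 (rmem s1) 1) (arr 2 (imem s'))) < card (bad (arr 1 (rmem s1)) y1 (arr 2 (imem s1)))"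
      let ?b = "B (arr 2 (rmem s1) 1) s'"
      have "same_but_kinetic s s'" using a s1(1) by (auto simp: same_but_kinetic_def)
      then have "Inv (?b * (event_cost m + 1)) s'" unfolding Inv_def using a h by blast
      moreover have "Suc ?b \<le> B y1 s1" using a by (simp add: B_def)
      then have "Suc ?b * (event_cost m + 1) \<le> b" unfolding s1(5) by (rule mult_le_mono1)
      then have "t + 1 + ?b * (event_cost m + 1) \<le> b" using a by simp
      ultimately show "\<exists>p'. Inv p' s' \<and> t + 1 + p' \<le> b" by blast
    qed
  qed
  then show ?thesis
  proof (rule run_mono)
    fix t s' assume "\<exists>b. Inv b s' \<and> \<not> beval (BNot (RLess rootPending regX)) s' \<and> t + b \<le> B y s * (event_cost m + 1) + 1"
    then obtain y' where "same_but_kinetic s s'" "x \<le> y'" "machine_tree m v s' y'"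
      "\<not> beval (BNot (RLess rootPending regX)) s'" "t + B y' s' * (event_cost m + 1) \<le> B y s * (event_cost m + 1) + 1"
      unfolding Inv_def by blast
    moreover from this have "arr 2 (rmem s') 1 < x" using x by (simp add: same_but_kinetic_def)
    ultimately show "same_but_kinetic s s' \<and> (\<exists>y'\<ge>x. machine_tree m v s' y' \<and> arr 2 (rmem s') 1 < x \<and>
     t + card (bad (arr 1 (rmem s')) y' (arr 2 (imem s'))) * (event_cost m + 1) \<le>
     card (bad (arr 1 (rmem s)) y (arr 2 (imem s))) * (event_cost m + 1) + 1)"
      unfolding B_def by blast
  qed
qed

end

section \<open>Scheduling one job\<close>

definition extract_job :: com where
  "extract_job =
     Seq (setreg 3 (iget 3 (IConst 1)))
    (Seq (rput 0 (IConst 2) (rget 4 (reg 3)))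
    (Seq (rput 4 (reg 3) (RConst 0))
    (Seq (setreg 1 (IHalf (IAdd regN (reg 3)))) (pull_up pull_job))))"

text \<open>The current size is lowered first, because recomputation evaluates the lines at
  \<open>regY\<close>.\<close>

definition assign_job :: com where
  "assign_job =
     Seq (rput 0 (IConst 1) regX)
    (Seq (setreg 4 (iget 2 (IConst 1)))
    (Seq (iput 4 (reg 3) (reg 4))
    (Seq (rput 1 (reg 4) (RAdd (rget 1 (reg 4)) (RDiv regX (speedE (reg 4)))))
    (Seq (setreg 1 (IHalf (IAdd regM (reg 4)))) (pull_up pull_machine)))))"

definition schedule_job :: com where
  "schedule_job = Seq extract_job (Seq events (Seq assign_job (setreg 2 (IAdd (reg 2) (IConst 1)))))"

text \<open>Selecting a largest job is the instance of the machine tree with loads \<open>- size\<close> and unit speeds.\<close>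

definition job_tree :: "int \<Rightarrow> state \<Rightarrow> bool" where
  "job_tree n s \<longleftrightarrow> tree_ok n (\<lambda>i. - arr 4 (rmem s) i) (\<lambda>_. 1) 0 (arr 3 (imem s)) (\<lambda>_. 0)"

lemma job_tree_cong:
  "job_tree n s \<Longrightarrow> arr 3 (imem s') = arr 3 (imem s) \<Longrightarrow> arr 4 (rmem s') = arr 4 (rmem s) \<Longrightarrow> job_tree n s'"
  by (simp add: job_tree_def)

lemma job_tree_root:
  assumes "job_tree n s" "1 \<le> n"
  shows "0 \<le> arr 3 (imem s) 1" "arr 3 (imem s) 1 < n"
    "0 \<le> i \<Longrightarrow> i < n \<Longrightarrow> arr 4 (rmem s) i \<le> arr 4 (rmem s) (arr 3 (imem s) 1)"
proof -
  interpret speeds n "\<lambda>_. 1" using assms by unfold_locales auto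
  note w = tree_winner[OF assms(1)[unfolded job_tree_def], of 1]
  show "0 \<le> arr 3 (imem s) 1" "arr 3 (imem s) 1 < n" using w assms by auto
  show "0 \<le> i \<Longrightarrow> i < n \<Longrightarrow> arr 4 (rmem s) i \<le> arr 4 (rmem s) (arr 3 (imem s) 1)"
    using w assms root_in_path[of "n + i"] by (auto simp: finish_def)
qed

definition extract_frame :: "state \<Rightarrow> state \<Rightarrow> bool" where
  "extract_frame s s' \<longleftrightarrow> arr 1 (imem s') = arr 1 (imem s) \<and> arr 2 (imem s') = arr 2 (imem s) \<and> arr 4 (imem s') = arr 4 (imem s) \<and>
     (\<forall>k. k \<notin> {1, 3} \<longrightarrow> arr 0 (imem s') k = arr 0 (imem s) k) \<and>
     (\<forall>k. k \<noteq> 2 \<longrightarrow> arr 0 (rmem s') k = arr 0 (rmem s) k) \<and>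
     arr 1 (rmem s') = arr 1 (rmem s) \<and> arr 2 (rmem s') = arr 2 (rmem s)"

lemma run_extract_job:
  assumes tree: "job_tree n s" and n: "1 \<le> n" "arr 0 (imem s) 0 = n"
    and i: "arr 3 (imem s) 1 = i"
  shows "run extract_job s (\<lambda>t s'. t \<le> 4 * blen (2 * n) + 5 \<and> extract_frame s s' \<and> job_tree n s' \<and>
     arr 0 (imem s') 3 = i \<and> arr 0 (rmem s') 2 = arr 4 (rmem s) i \<and> arr 4 (rmem s') = (arr 4 (rmem s))(i := 0))"
proof -
  interpret speeds n "\<lambda>_. 1" using n by unfold_locales auto
  have ir: "0 \<le> i" "i < n" using job_tree_root[OF tree n(1)] i by auto
  let ?K = "arr 4 (rmem s)"
  define s1 where "s1 = s\<lparr>imem := (imem s)(adr 0 3 := i), rmem := (rmem s)(adr 0 2 := ?K i, adr 4 i := 0),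
      imem := (imem s)(adr 0 3 := i, adr 0 1 := (n + i) div 2)\<rparr>"
  have s1: "arr 0 (imem s1) 1 = (n + i) div 2" "arr 3 (imem s1) = arr 3 (imem s)" "arr 4 (rmem s1) = ?K(i := 0)"
    "arr 0 (imem s1) 3 = i" "arr 0 (rmem s1) 2 = ?K i" "extract_frame s s1"
    using ir by (simp_all add: s1_def extract_frame_def)
  have u: "0 \<le> (n + i) div 2" "(n + i) div 2 < n" using ir by auto
  have w: "0 \<le> arr 3 (imem s) q \<and> arr 3 (imem s) q < n" if "1 \<le> q" "q < 2 * n" for q
    using tree_winner[OF tree[unfolded job_tree_def] that] by simp
  have pull: "run (pull_up pull_job) s1 (\<lambda>t s'. 4 + t \<le> 4 * blen (2 * n) + 5 \<and> extract_frame s s' \<and> job_tree n s' \<and>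
     arr 0 (imem s') 3 = i \<and> arr 0 (rmem s') 2 = ?K i \<and> arr 4 (rmem s') = ?K(i := 0))"
  proof (rule run_mono[OF run_pull_up_job[of n s1, OF _ s1(1) u]])
    show "1 \<le> q \<Longrightarrow> q < 2 * n \<Longrightarrow> 0 \<le> arr 3 (imem s1) q \<and> arr 3 (imem s1) q < n" for q
      using w s1 by simp
    fix t s'
    assume a: "t \<le> 4 * blen ((n + i) div 2) + 1 \<and> same_but_jobs s1 s' \<and>
      (\<forall>q\<in>path ((n + i) div 2). pulled (\<lambda>i. - arr 4 (rmem s1) i) (\<lambda>_. 1) 0 (arr 3 (imem s')) (\<lambda>_. 0) q) \<and>
      (\<forall>q. q \<notin> path ((n + i) div 2) \<longrightarrow> arr 3 (imem s') q = arr 3 (imem s1) q)"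
    have K: "arr 4 (rmem s') = ?K(i := 0)" using a s1 by (simp add: same_but_jobs_def)
    have "job_tree n s'"
      unfolding job_tree_def K
    proof (rule tree_ok_repull[OF tree[unfolded job_tree_def] _ u(2)])
      show "path ((n + k) div 2) \<subseteq> path ((n + i) div 2)" if "- (?K(i := 0)) k \<noteq> - ?K k" for k
        using that by (auto split: if_splits)
    qed (use a s1 in simp_all)
    moreover have "extract_frame s s'" "arr 0 (imem s') 3 = i" "arr 0 (rmem s') 2 = ?K i"
      using a s1 by (simp_all add: same_but_jobs_def extract_frame_def)
    moreover have "blen ((n + i) div 2) \<le> blen (2 * n)" using u by (intro blen_mono) auto
    ultimately show "4 + t \<le> 4 * blen (2 * n) + 5 \<and> extract_frame s s' \<and> job_tree n s' \<and>
     arr 0 (imem s') 3 = i \<and> arr 0 (rmem s') 2 = ?K i \<and> arr 4 (rmem s') = ?K(i := 0)"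
      using a K by simp
  qed
  show ?thesis
    unfolding extract_job_def
    apply (rule run_Seq, rule run_iput, rule run_Seq, rule run_rput, rule run_Seq, rule run_rput, rule run_Seq, rule run_iput)
    using pull i ir n by (simp add: s1_def add.assoc)
qed

definition assign_frame :: "state \<Rightarrow> state \<Rightarrow> bool" where
  "assign_frame s s' \<longleftrightarrow> arr 1 (imem s') = arr 1 (imem s) \<and> arr 3 (imem s') = arr 3 (imem s) \<and>
     (\<forall>k. k \<notin> {1, 4, 5, 6} \<longrightarrow> arr 0 (imem s') k = arr 0 (imem s) k) \<and> arr 4 (rmem s') = arr 4 (rmem s)"

context speeds
begin

lemma run_assign_job:
  assumes mem: "mem_ok n m v s" and ok: "machine_tree m v s y"
    and x: "arr 0 (rmem s) 2 = x" "0 < x" "x \<le> y" "arr 2 (rmem s) 1 < x"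
    and i: "arr 0 (imem s) 3 = i" "0 \<le> i" and j: "arr 2 (imem s) 1 = j"
  shows "run assign_job s (\<lambda>t s'. t \<le> 12 * blen (2 * m) + 6 \<and> assign_frame s s' \<and> arr 0 (rmem s') 1 = x \<and>
     machine_tree m v s' x \<and> 0 \<le> j \<and> j < m \<and>
     (\<forall>k. 0 \<le> k \<longrightarrow> k < m \<longrightarrow> finish (arr 1 (rmem s)) v x j \<le> finish (arr 1 (rmem s)) v x k) \<and>
     arr 1 (rmem s') = (arr 1 (rmem s))(j := arr 1 (rmem s) j + x / v j) \<and>
     arr 4 (imem s') = (arr 4 (imem s))(i := j) \<and>
     card (bad (arr 1 (rmem s')) x (arr 2 (imem s'))) \<le> card (bad (arr 1 (rmem s)) y (arr 2 (imem s))) + blen (2 * m))"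
proof -
  let ?T = "arr 1 (rmem s)" and ?W = "arr 2 (imem s)" and ?H = "arr 2 (rmem s)"
  let ?T' = "?T(j := ?T j + x / v j)"
  \<comment> \<open>No flip is pending from \<open>y\<close> down to \<open>x\<close>, so the root's
    winner at \<open>x\<close> is already the machine that LPT asks for.\<close>
  have okx: "tree_ok m ?T v x ?W ?H" using tree_ok_advance[OF ok] x by simp
  have jr: "0 \<le> j" "j < m" using tree_winner[OF okx, of 1] m_pos j by auto
  have jmin: "finish ?T v x j \<le> finish ?T v x k" if "0 \<le> k" "k < m" for k
    using tree_winner[OF okx, of 1] m_pos j that root_in_path[of "m + k"] by auto
  have n: "0 \<le> n" "arr 0 (imem s) 0 = n" "arr 1 (imem s) 0 = m" "arr 4 (rmem s) (n + j) = v j"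
    using mem jr by (auto simp: mem_ok_def)
  define s1 where "s1 = s\<lparr>rmem := (rmem s)(adr 0 1 := x), imem := (imem s)(adr 0 4 := j, adr 4 i := j),
     rmem := (rmem s)(adr 0 1 := x, adr 1 j := ?T j + x / v j),
     imem := (imem s)(adr 0 4 := j, adr 4 i := j, adr 0 1 := (m + j) div 2)\<rparr>"
  have s1: "arr 0 (imem s1) 1 = (m + j) div 2" "arr 2 (imem s1) = ?W" "arr 1 (rmem s1) = ?T'" "arr 2 (rmem s1) = ?H"
    "arr 0 (rmem s1) 1 = x" "arr 4 (imem s1) = (arr 4 (imem s))(i := j)" "assign_frame s s1"
    using i jr by (simp_all add: s1_def assign_frame_def)
  have mem1: "mem_ok n m v s1" using mem s1(7) by (simp add: mem_ok_def assign_frame_def)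
  have u: "0 \<le> (m + j) div 2" "(m + j) div 2 < m" using jr by auto
  have pull: "run (pull_up pull_machine) s1 (\<lambda>t s'. 5 + t \<le> 12 * blen (2 * m) + 6 \<and> assign_frame s s' \<and> arr 0 (rmem s') 1 = x \<and>
     machine_tree m v s' x \<and> 0 \<le> j \<and> j < m \<and>
     (\<forall>k. 0 \<le> k \<longrightarrow> k < m \<longrightarrow> finish ?T v x j \<le> finish ?T v x k) \<and> arr 1 (rmem s') = ?T' \<and>
     arr 4 (imem s') = (arr 4 (imem s))(i := j) \<and>
     card (bad (arr 1 (rmem s')) x (arr 2 (imem s'))) \<le> card (bad ?T y ?W) + blen (2 * m))"
  proof (rule run_mono[OF run_pull_up_machine[OF mem1 _ s1(1) u]])
    show "1 \<le> q \<Longrightarrow> q < 2 * m \<Longrightarrow> 0 \<le> arr 2 (imem s1) q \<and> arr 2 (imem s1) q < m" for q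
      using tree_winner[OF ok] s1 by simp
    fix t s'
    assume a: "t \<le> 12 * blen ((m + j) div 2) + 1 \<and> same_but_machines s1 s' \<and>
      (\<forall>q\<in>path ((m + j) div 2). pulled (arr 1 (rmem s1)) v (arr 0 (rmem s1) 1) (arr 2 (imem s')) (arr 2 (rmem s')) q) \<and>
      (\<forall>q. q \<notin> path ((m + j) div 2) \<longrightarrow> arr 2 (imem s') q = arr 2 (imem s1) q \<and> arr 2 (rmem s') q = arr 2 (rmem s1) q)"
    have fr: "arr 1 (rmem s') = ?T'" "assign_frame s s'" "arr 0 (rmem s') 1 = x" "arr 4 (imem s') = (arr 4 (imem s))(i := j)"
      using a s1 by (auto simp: same_but_machines_def assign_frame_def)
    have T: "?T j \<le> ?T' j" "\<And>i. i \<noteq> j \<Longrightarrow> ?T' i = ?T i" using x v_pos[OF jr] by simp_all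
    have on: "\<And>q. q \<in> path ((m + j) div 2) \<Longrightarrow> pulled ?T' v x (arr 2 (imem s')) (arr 2 (rmem s')) q"
      and off: "\<And>q. q \<notin> path ((m + j) div 2) \<Longrightarrow> arr 2 (imem s') q = ?W q \<and> arr 2 (rmem s') q = ?H q"
      using a s1 by simp_all
    note r = update_repull[OF okx x(2,4) jr T on off]
    have "card (bad ?T x ?W) \<le> card (bad ?T y ?W)" by (intro card_mono bad_advance x) simp
    moreover have "blen ((m + j) div 2) \<le> blen (2 * m)" using u by (intro blen_mono) auto
    ultimately show "5 + t \<le> 12 * blen (2 * m) + 6 \<and> assign_frame s s' \<and> arr 0 (rmem s') 1 = x \<and>
     machine_tree m v s' x \<and> 0 \<le> j \<and> j < m \<and>
     (\<forall>k. 0 \<le> k \<longrightarrow> k < m \<longrightarrow> finish ?T v x j \<le> finish ?T v x k) \<and> arr 1 (rmem s') = ?T' \<and>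
     arr 4 (imem s') = (arr 4 (imem s))(i := j) \<and>
     card (bad (arr 1 (rmem s')) x (arr 2 (imem s'))) \<le> card (bad ?T y ?W) + blen (2 * m)"
      using a r fr jr jmin by simp
  qed
  show ?thesis
    unfolding assign_job_def
    apply (rule run_Seq, rule run_rput, rule run_Seq, rule run_iput, rule run_Seq, rule run_iput, rule run_Seq, rule run_rput, rule run_Seq, rule run_iput)
    using pull i j jr n x by (simp add: s1_def add.assoc)
qed

definition budget :: "state \<Rightarrow> nat" where
  "budget s = card (bad (arr 1 (rmem s)) (arr 0 (rmem s) 1) (arr 2 (imem s))) * (event_cost m + 1)"

text \<open>Besides the direct work, each job is charged for the bad pairs its assignment may
  create. The constant 13 is 5 for extraction, 6 for assignment, 1 for leaving the flip loop and 1
  for the counter.\<close>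

definition job_cost :: "int \<Rightarrow> nat" where
  "job_cost n = 4 * blen (2 * n) + 12 * blen (2 * m) + 13 + blen (2 * m) * (event_cost m + 1)"

text \<open>Amortised accounting: the flips triggered here are paid from \<open>budget s\<close>,
  and \<open>job_cost n\<close> refills it for the later ones.\<close>

lemma run_schedule_job:
  assumes mem: "mem_ok n m v s" and n: "1 \<le> n" and jobs: "job_tree n s" and ok: "machine_tree m v s y"
    and y: "arr 0 (rmem s) 1 = y" and i: "arr 3 (imem s) 1 = i" and x: "arr 4 (rmem s) i = x" "0 < x" "x \<le> y"
  shows "run schedule_job s (\<lambda>t s'. t + budget s' \<le> budget s + job_cost n \<and>
     mem_ok n m v s' \<and> job_tree n s' \<and> machine_tree m v s' x \<and> arr 0 (rmem s') 1 = x \<and>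
     arr 0 (imem s') 2 = arr 0 (imem s) 2 + 1 \<and> arr 4 (rmem s') = (arr 4 (rmem s))(i := 0) \<and>
     (\<exists>j. 0 \<le> j \<and> j < m \<and> (\<forall>k. 0 \<le> k \<longrightarrow> k < m \<longrightarrow> finish (arr 1 (rmem s)) v x j \<le> finish (arr 1 (rmem s)) v x k) \<and>
       arr 1 (rmem s') = (arr 1 (rmem s))(j := arr 1 (rmem s) j + x / v j) \<and>
       arr 4 (imem s') = (arr 4 (imem s))(i := j)))"
proof -
  have ir: "0 \<le> i" "i < n" using job_tree_root[OF jobs n] i by auto
  have n0: "arr 0 (imem s) 0 = n" using mem by (simp add: mem_ok_def)
  show ?thesis
    unfolding schedule_job_def
  proof (rule run_Seq, rule run_mono[OF run_extract_job[OF jobs n n0 i]], rule run_Seq)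
    fix t1 s1
    assume a1: "t1 \<le> 4 * blen (2 * n) + 5 \<and> extract_frame s s1 \<and> job_tree n s1 \<and>
     arr 0 (imem s1) 3 = i \<and> arr 0 (rmem s1) 2 = arr 4 (rmem s) i \<and> arr 4 (rmem s1) = (arr 4 (rmem s))(i := 0)"
    have mem1: "mem_ok n m v s1" using mem a1 ir by (simp add: mem_ok_def extract_frame_def)
    have s1: "machine_tree m v s1 y" "arr 0 (rmem s1) 1 = y" "arr 0 (rmem s1) 2 = x"
      using a1 ok y x by (simp_all add: extract_frame_def)
    have b1: "budget s1 = budget s" using a1 by (simp add: budget_def extract_frame_def)
    show "run events s1 (\<lambda>t2 s2. run (Seq assign_job (setreg 2 (IAdd (reg 2) (IConst 1)))) s2 (\<lambda>t3 s'.
       t1 + (t2 + t3) + budget s' \<le> budget s + job_cost n \<and>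
       mem_ok n m v s' \<and> job_tree n s' \<and> machine_tree m v s' x \<and> arr 0 (rmem s') 1 = x \<and>
       arr 0 (imem s') 2 = arr 0 (imem s) 2 + 1 \<and> arr 4 (rmem s') = (arr 4 (rmem s))(i := 0) \<and>
       (\<exists>j. 0 \<le> j \<and> j < m \<and> (\<forall>k. 0 \<le> k \<longrightarrow> k < m \<longrightarrow> finish (arr 1 (rmem s)) v x j \<le> finish (arr 1 (rmem s)) v x k) \<and>
         arr 1 (rmem s') = (arr 1 (rmem s))(j := arr 1 (rmem s) j + x / v j) \<and>
         arr 4 (imem s') = (arr 4 (imem s))(i := j))))"
    proof (rule run_mono[OF run_events[OF mem1 s1 x(2,3)]], elim conjE exE, rule run_Seq)
      fix t2 s2 y'
      assume a2: "same_but_kinetic s1 s2" "y' \<ge> x" "machine_tree m v s2 y'" "arr 2 (rmem s2) 1 < x"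
        "t2 + card (bad (arr 1 (rmem s2)) y' (arr 2 (imem s2))) * (event_cost m + 1) \<le>
         card (bad (arr 1 (rmem s1)) y (arr 2 (imem s1))) * (event_cost m + 1) + 1"
      have b2: "t2 + card (bad (arr 1 (rmem s2)) y' (arr 2 (imem s2))) * (event_cost m + 1) \<le> budget s + 1"
        using a2(5) b1 s1(2) by (simp add: budget_def)
      have T: "arr 1 (rmem s2) = arr 1 (rmem s)" "arr 4 (imem s2) = arr 4 (imem s)" "arr 0 (imem s2) 2 = arr 0 (imem s) 2"
        "arr 4 (rmem s2) = (arr 4 (rmem s))(i := 0)"
        using a1 a2(1) by (simp_all add: extract_frame_def same_but_kinetic_def)
      have "job_tree n s2"
        by (rule job_tree_cong[of n s1]) (use a1 a2(1) in \<open>auto simp: same_but_kinetic_def\<close>)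
      then have s2: "arr 0 (rmem s2) 2 = x" "arr 0 (imem s2) 3 = i" "job_tree n s2"
        using a1 a2(1) s1 by (simp_all add: same_but_kinetic_def)
      show "run assign_job s2 (\<lambda>t3 s3. run (setreg 2 (IAdd (reg 2) (IConst 1))) s3 (\<lambda>t4 s'.
         t1 + (t2 + (t3 + t4)) + budget s' \<le> budget s + job_cost n \<and>
         mem_ok n m v s' \<and> job_tree n s' \<and> machine_tree m v s' x \<and> arr 0 (rmem s') 1 = x \<and>
         arr 0 (imem s') 2 = arr 0 (imem s) 2 + 1 \<and> arr 4 (rmem s') = (arr 4 (rmem s))(i := 0) \<and>
         (\<exists>j. 0 \<le> j \<and> j < m \<and> (\<forall>k. 0 \<le> k \<longrightarrow> k < m \<longrightarrow> finish (arr 1 (rmem s)) v x j \<le> finish (arr 1 (rmem s)) v x k) \<and>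
           arr 1 (rmem s') = (arr 1 (rmem s))(j := arr 1 (rmem s) j + x / v j) \<and>
           arr 4 (imem s') = (arr 4 (imem s))(i := j))))"
      proof (rule run_mono[OF run_assign_job[OF mem_ok_kinetic[OF mem1 a2(1)] a2(3) s2(1) x(2) a2(2,4) s2(2) ir(1) refl]], rule run_iput)
        fix t3 s3
        assume a3: "t3 \<le> 12 * blen (2 * m) + 6 \<and> assign_frame s2 s3 \<and> arr 0 (rmem s3) 1 = x \<and>
         machine_tree m v s3 x \<and> 0 \<le> arr 2 (imem s2) 1 \<and> arr 2 (imem s2) 1 < m \<and>
         (\<forall>k. 0 \<le> k \<longrightarrow> k < m \<longrightarrow> finish (arr 1 (rmem s2)) v x (arr 2 (imem s2) 1) \<le> finish (arr 1 (rmem s2)) v x k) \<and>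
         arr 1 (rmem s3) = (arr 1 (rmem s2))(arr 2 (imem s2) 1 := arr 1 (rmem s2) (arr 2 (imem s2) 1) + x / v (arr 2 (imem s2) 1)) \<and>
         arr 4 (imem s3) = (arr 4 (imem s2))(i := arr 2 (imem s2) 1) \<and>
         card (bad (arr 1 (rmem s3)) x (arr 2 (imem s3))) \<le> card (bad (arr 1 (rmem s2)) y' (arr 2 (imem s2))) + blen (2 * m)"
        define s4 where "s4 = s3\<lparr>imem := (imem s3)(adr 0 (ieval (IConst 2) s3) := ieval (IAdd (reg 2) (IConst 1)) s3)\<rparr>"
        have s4: "arr 0 (imem s4) = (arr 0 (imem s3))(2 := arr 0 (imem s3) 2 + 1)" "rmem s4 = rmem s3"
          "\<And>c. c \<in> {1,2,3,4} \<Longrightarrow> arr c (imem s4) = arr c (imem s3)"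
          by (auto simp: s4_def)
        have "card (bad (arr 1 (rmem s3)) x (arr 2 (imem s3))) * (event_cost m + 1) \<le>
           (card (bad (arr 1 (rmem s2)) y' (arr 2 (imem s2))) + blen (2 * m)) * (event_cost m + 1)"
          by (rule mult_le_mono1) (use a3 in blast)
        moreover have "arr 0 (rmem s3) 1 = x" using a3 by blast
        ultimately have "budget s4 \<le> card (bad (arr 1 (rmem s2)) y' (arr 2 (imem s2))) * (event_cost m + 1) + blen (2 * m) * (event_cost m + 1)"
          by (simp add: budget_def s4 add_mult_distrib)
        then have t: "t1 + (t2 + (t3 + 1)) + budget s4 \<le> budget s + job_cost n"
          using a1 b2 a3 unfolding job_cost_def by linarith
        have "mem_ok n m v s3" using mem_ok_kinetic[OF mem1 a2(1)] a3 by (simp add: mem_ok_def assign_frame_def)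
        then have "mem_ok n m v s4" by (simp add: mem_ok_def s4)
        moreover have "job_tree n s4"
          by (rule job_tree_cong[OF s2(3)]) (use a3 in \<open>auto simp: assign_frame_def s4\<close>)
        moreover have "machine_tree m v s4 x \<and> arr 0 (rmem s4) 1 = x"
        proof -
          have "arr 2 (imem s4) = arr 2 (imem s3)" by (simp add: s4)
          show ?thesis unfolding s4(2) \<open>arr 2 (imem s4) = arr 2 (imem s3)\<close> using a3 by blast
        qed
        moreover have "arr 0 (imem s4) 2 = arr 0 (imem s) 2 + 1 \<and> arr 4 (rmem s4) = (arr 4 (rmem s))(i := 0)"
          using a3 T by (simp add: s4 assign_frame_def)
        moreover have "\<exists>j. 0 \<le> j \<and> j < m \<and> (\<forall>k. 0 \<le> k \<longrightarrow> k < m \<longrightarrow> finish (arr 1 (rmem s)) v x j \<le> finish (arr 1 (rmem s)) v x k) \<and>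
           arr 1 (rmem s4) = (arr 1 (rmem s))(j := arr 1 (rmem s) j + x / v j) \<and>
           arr 4 (imem s4) = (arr 4 (imem s))(i := j)"
          by (rule exI[of _ "arr 2 (imem s2) 1"]) (use a3 in \<open>simp add: s4 T\<close>)
        ultimately show "t1 + (t2 + (t3 + 1)) + budget s4 \<le> budget s + job_cost n \<and>
           mem_ok n m v s4 \<and> job_tree n s4 \<and> machine_tree m v s4 x \<and> arr 0 (rmem s4) 1 = x \<and>
           arr 0 (imem s4) 2 = arr 0 (imem s) 2 + 1 \<and> arr 4 (rmem s4) = (arr 4 (rmem s))(i := 0) \<and>
           (\<exists>j. 0 \<le> j \<and> j < m \<and> (\<forall>k. 0 \<le> k \<longrightarrow> k < m \<longrightarrow> finish (arr 1 (rmem s)) v x j \<le> finish (arr 1 (rmem s)) v x k) \<and>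
             arr 1 (rmem s4) = (arr 1 (rmem s))(j := arr 1 (rmem s) j + x / v j) \<and>
             arr 4 (imem s4) = (arr 4 (imem s))(i := j))"
          using t by blast
      qed
    qed
  qed
qed

end

section \<open>Partial LPT runs\<close>

definition partial_LPT :: "nat \<Rightarrow> nat \<Rightarrow> (nat \<Rightarrow> real) \<Rightarrow> (nat \<Rightarrow> real) \<Rightarrow> (nat \<Rightarrow> nat) \<Rightarrow> (nat \<Rightarrow> nat) \<Rightarrow> nat \<Rightarrow> bool" where
  "partial_LPT n m l v \<pi> \<sigma> k \<longleftrightarrow> k \<le> n \<and> inj_on \<pi> {..<k} \<and> \<pi> ` {..<k} \<subseteq> {..<n} \<and>
     (\<forall>b<k. \<sigma> (\<pi> b) < m) \<and> (\<forall>a b. a \<le> b \<longrightarrow> b < k \<longrightarrow> l (\<pi> b) \<le> l (\<pi> a)) \<and>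
     (\<forall>b<k. \<forall>j<m. lpt_load l v \<pi> \<sigma> b (\<sigma> (\<pi> b)) + l (\<pi> b) / v (\<sigma> (\<pi> b)) \<le> lpt_load l v \<pi> \<sigma> b j + l (\<pi> b) / v j)"

lemma lpt_load_cong:
  assumes "\<And>a. a < k \<Longrightarrow> \<pi>' a = \<pi> a \<and> \<sigma>' (\<pi> a) = \<sigma> (\<pi> a)"
  shows "lpt_load l v \<pi>' \<sigma>' k j = lpt_load l v \<pi> \<sigma> k j"
  unfolding lpt_load_def by (rule sum.cong) (use assms in auto)

lemma lpt_load_Suc:
  "lpt_load l v \<pi> \<sigma> (Suc k) j = lpt_load l v \<pi> \<sigma> k j + (if \<sigma> (\<pi> k) = j then l (\<pi> k) / v j else 0)"
proof (cases "\<sigma> (\<pi> k) = j")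
  case True
  then have "{k'. k' < Suc k \<and> \<sigma> (\<pi> k') = j} = insert k {k'. k' < k \<and> \<sigma> (\<pi> k') = j}" by auto
  then show ?thesis using True by (simp add: lpt_load_def)
next
  case False
  then have "{k'. k' < Suc k \<and> \<sigma> (\<pi> k') = j} = {k'. k' < k \<and> \<sigma> (\<pi> k') = j}" by (auto simp: less_Suc_eq)
  then show ?thesis using False by (simp add: lpt_load_def)
qed

text \<open>Loads up to time \<open>k\<close> involve only jobs placed earlier, and \<open>i\<close>
  is not among them, so the new values at \<open>k\<close> and at \<open>i\<close> leave all earlier
  choices intact.\<close>

lemma partial_LPT_step:
  assumes p: "partial_LPT n m l v \<pi> \<sigma> k" and i: "i < n" "i \<notin> \<pi> ` {..<k}" "\<And>b. b < k \<Longrightarrow> l i \<le> l (\<pi> b)"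
    and j: "j < m" "\<And>j'. j' < m \<Longrightarrow> lpt_load l v \<pi> \<sigma> k j + l i / v j \<le> lpt_load l v \<pi> \<sigma> k j' + l i / v j'"
    and \<sigma>': "\<sigma>' i = j" "\<And>a. a \<noteq> i \<Longrightarrow> \<sigma>' a = \<sigma> a"
  shows "partial_LPT n m l v (\<pi>(k := i)) \<sigma>' (Suc k)"
    and "lpt_load l v (\<pi>(k := i)) \<sigma>' (Suc k) j' = lpt_load l v \<pi> \<sigma> k j' + (if j = j' then l i / v j' else 0)"
proof -
  have s: "\<sigma>' (\<pi> b) = \<sigma> (\<pi> b)" if "b < k" for b using \<sigma>'(2)[of "\<pi> b"] i that by auto
  have old: "lpt_load l v (\<pi>(k := i)) \<sigma>' b j = lpt_load l v \<pi> \<sigma> b j" if "b \<le> k" for b j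
    by (rule lpt_load_cong) (use that s in auto)
  show "lpt_load l v (\<pi>(k := i)) \<sigma>' (Suc k) j' = lpt_load l v \<pi> \<sigma> k j' + (if j = j' then l i / v j' else 0)"
    using \<sigma>' by (simp add: lpt_load_Suc old)
  have P: "inj_on \<pi> {..<k}" "\<And>b. b < k \<Longrightarrow> \<pi> b < n" "\<And>b. b < k \<Longrightarrow> \<sigma> (\<pi> b) < m"
    "\<And>a b. a \<le> b \<Longrightarrow> b < k \<Longrightarrow> l (\<pi> b) \<le> l (\<pi> a)"
    "\<And>b j. b < k \<Longrightarrow> j < m \<Longrightarrow>
      lpt_load l v \<pi> \<sigma> b (\<sigma> (\<pi> b)) + l (\<pi> b) / v (\<sigma> (\<pi> b)) \<le> lpt_load l v \<pi> \<sigma> b j + l (\<pi> b) / v j"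
    using p unfolding partial_LPT_def by blast+
  \<comment> \<open>Pigeonhole: the injective image of \<open>{..<k}\<close> misses
    \<open>i\<close>, hence \<open>k < n\<close>.\<close>
  have "\<pi> ` {..<k} \<subseteq> {..<n} - {i}" using P(2) i(2) by auto
  then have "card (\<pi> ` {..<k}) \<le> card ({..<n} - {i})" by (intro card_mono) auto
  then have "k < n" using i(1) card_image[OF P(1)] by simp
  moreover have "inj_on (\<pi>(k := i)) {..<Suc k}"
    using P(1) i(2) by (auto simp: lessThan_Suc inj_on_def)
  moreover have "(\<pi>(k := i)) ` {..<Suc k} \<subseteq> {..<n}" using P(2) i(1) by (auto simp: less_Suc_eq)
  moreover have "\<sigma>' ((\<pi>(k := i)) b) < m" if "b < Suc k" for b
    using that s[of b] P(3)[of b] j(1) \<sigma>'(1) by (cases "b = k") auto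
  moreover have "l ((\<pi>(k := i)) b) \<le> l ((\<pi>(k := i)) a)" if "a \<le> b" "b < Suc k" for a b
    using that P(4)[of a b] i(3)[of a] by (cases "b = k"; cases "a = k") auto
  moreover have "lpt_load l v (\<pi>(k := i)) \<sigma>' b (\<sigma>' ((\<pi>(k := i)) b)) + l ((\<pi>(k := i)) b) / v (\<sigma>' ((\<pi>(k := i)) b))
      \<le> lpt_load l v (\<pi>(k := i)) \<sigma>' b j' + l ((\<pi>(k := i)) b) / v j'" if "b < Suc k" "j' < m" for b j'
    using that P(5)[of b j'] j(2)[of j'] \<sigma>'(1) s[of b] old[of b] by (cases "b = k") auto
  ultimately show "partial_LPT n m l v (\<pi>(k := i)) \<sigma>' (Suc k)"
    unfolding partial_LPT_def by (intro conjI allI impI Suc_leI) blast+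
qed

text \<open>An injective self-map of a finite set is onto, so \<open>\<pi>\<close> is a permutation,
  and reindexing along it turns final loads into completion times.\<close>

lemma partial_LPT_complete:
  assumes p: "partial_LPT n m l v \<pi> \<sigma> n"
  shows "is_LPT_schedule n m l v \<sigma>" "lpt_load l v \<pi> \<sigma> n j = completion_time n l v \<sigma> j"
proof -
  have "\<pi> ` {..<n} = {..<n}"
    using p unfolding partial_LPT_def by (intro endo_inj_surj) blast+
  then have bij: "bij_betw \<pi> {..<n} {..<n}" using p by (simp add: partial_LPT_def bij_betw_def)
  have "\<sigma> i < m" if "i < n" for i
  proof -
    have "i \<in> \<pi> ` {..<n}" using \<open>\<pi> ` {..<n} = {..<n}\<close> that by simp
    then obtain b where "b < n" "i = \<pi> b" by auto
    then show ?thesis using p by (simp add: partial_LPT_def)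
  qed
  then show "is_LPT_schedule n m l v \<sigma>"
    using p bij unfolding is_LPT_schedule_def valid_schedule_def partial_LPT_def by blast
  have "bij_betw \<pi> {k'. k' < n \<and> \<sigma> (\<pi> k') = j} {i. i < n \<and> \<sigma> i = j}"
  proof (rule bij_betw_subset[OF bij])
    show "\<pi> ` {k'. k' < n \<and> \<sigma> (\<pi> k') = j} = {i. i < n \<and> \<sigma> i = j}"
    proof
      show "\<pi> ` {k'. k' < n \<and> \<sigma> (\<pi> k') = j} \<subseteq> {i. i < n \<and> \<sigma> i = j}"
        using \<open>\<pi> ` {..<n} = {..<n}\<close> by auto
      show "{i. i < n \<and> \<sigma> i = j} \<subseteq> \<pi> ` {k'. k' < n \<and> \<sigma> (\<pi> k') = j}"
      proof
        fix i assume i: "i \<in> {i. i < n \<and> \<sigma> i = j}"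
        then have "i \<in> \<pi> ` {..<n}" using \<open>\<pi> ` {..<n} = {..<n}\<close> by simp
        then show "i \<in> \<pi> ` {k'. k' < n \<and> \<sigma> (\<pi> k') = j}" using i by auto
      qed
    qed
  qed auto
  then show "lpt_load l v \<pi> \<sigma> n j = completion_time n l v \<sigma> j"
    unfolding lpt_load_def completion_time_def by (rule sum.reindex_bij_betw)
qed

section \<open>The program\<close>

definition leaves :: "int \<Rightarrow> iexp \<Rightarrow> com" where
  "leaves c e = Seq (setreg 2 (IConst 0)) (While (ILess (reg 2) e)
     (Seq (iput c (IAdd e (reg 2)) (reg 2)) (setreg 2 (IAdd (reg 2) (IConst 1)))))"

text \<open>The loop evaluates \<open>e\<close> again while register 2 and array \<open>c\<close>
  are being written, so \<open>e\<close> may depend only on integer array 1 and register 0.\<close>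

lemma run_leaves:
  assumes e: "\<And>s'. arr 1 (imem s') = arr 1 (imem s) \<Longrightarrow> arr 0 (imem s') 0 = arr 0 (imem s) 0 \<Longrightarrow> ieval e s' = q"
    and c: "c = 2 \<or> c = 3" and q: "0 \<le> q"
  shows "run (leaves c e) s (\<lambda>t s'. t \<le> 3 * nat q + 2 \<and> rmem s' = rmem s \<and>
     (\<forall>k. k \<noteq> 2 \<longrightarrow> arr 0 (imem s') k = arr 0 (imem s) k) \<and>
     (\<forall>c'\<in>{1,2,3,4} - {c}. arr c' (imem s') = arr c' (imem s)) \<and>
     arr c (imem s') = (\<lambda>u. if q \<le> u \<and> u < 2 * q then u - q else arr c (imem s) u))"
proof -
  define Inv where "Inv b s' \<longleftrightarrow> (\<exists>k. 0 \<le> k \<and> k \<le> q \<and> arr 0 (imem s') 2 = k \<and> b = 3 * nat (q - k) \<and> rmem s' = rmem s \<and>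
     (\<forall>k. k \<noteq> 2 \<longrightarrow> arr 0 (imem s') k = arr 0 (imem s) k) \<and>
     (\<forall>c'\<in>{1,2,3,4} - {c}. arr c' (imem s') = arr c' (imem s)) \<and>
     arr c (imem s') = (\<lambda>u. if q \<le> u \<and> u < q + k then u - q else arr c (imem s) u))" for b and s' :: state
  have cond: "arr 1 (imem s') = arr 1 (imem s) \<and> arr 0 (imem s') 0 = arr 0 (imem s) 0 \<and> ieval e s' = q" if "Inv b s'" for b s'
  proof -
    have "arr 1 (imem s') = arr 1 (imem s)" "arr 0 (imem s') 0 = arr 0 (imem s) 0" using that c by (auto simp: Inv_def)
    then show ?thesis using e by simp
  qed
  have loop: "run (While (ILess (reg 2) e) (Seq (iput c (IAdd e (reg 2)) (reg 2)) (setreg 2 (IAdd (reg 2) (IConst 1))))) s0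
     (\<lambda>t s'. \<exists>b. Inv b s' \<and> \<not> beval (ILess (reg 2) e) s' \<and> t + b \<le> 3 * nat q + 1)" if "Inv (3 * nat q) s0" for s0
  proof (rule run_While[where I = Inv, OF that])
    fix b s1 assume inv: "Inv b s1" and bev: "beval (ILess (reg 2) e) s1"
    then obtain k where k: "0 \<le> k" "k \<le> q" "arr 0 (imem s1) 2 = k" "b = 3 * nat (q - k)" "rmem s1 = rmem s"
      "\<forall>k. k \<noteq> 2 \<longrightarrow> arr 0 (imem s1) k = arr 0 (imem s) k"
      "\<forall>c'\<in>{1,2,3,4} - {c}. arr c' (imem s1) = arr c' (imem s)"
      "arr c (imem s1) = (\<lambda>u. if q \<le> u \<and> u < q + k then u - q else arr c (imem s) u)"
      unfolding Inv_def by blast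
    have "k < q" using bev cond[OF inv] k by simp
    define s2 where "s2 = s1\<lparr>imem := (imem s1)(adr c (q + k) := k, adr 0 2 := k + 1)\<rparr>"
    have "Inv (3 * nat (q - (k + 1))) s2"
      unfolding Inv_def
    proof (intro exI[of _ "k + 1"] conjI)
      show "\<forall>c'\<in>{1, 2, 3, 4} - {c}. arr c' (imem s2) = arr c' (imem s)"
        using k(1,7) c q by (auto simp: s2_def)
      show "\<forall>k. k \<noteq> 2 \<longrightarrow> arr 0 (imem s2) k = arr 0 (imem s) k"
        using k(1,6) c q by (auto simp: s2_def)
      show "arr 0 (imem s2) 2 = k + 1" using c q k(1) by (auto simp: s2_def)
      show "rmem s2 = rmem s" using k(5) by (simp add: s2_def)
      show "arr c (imem s2) = (\<lambda>u. if q \<le> u \<and> u < q + (k + 1) then u - q else arr c (imem s) u)"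
      proof -
        have "arr c (imem s2) = (arr c (imem s1))(q + k := k)" using c q k(1) by (auto simp: s2_def)
        then show ?thesis using k(1) unfolding k(8) by (auto simp: fun_eq_iff)
      qed
    qed (use k(1) \<open>k < q\<close> in auto)
    moreover have "3 + 3 * nat (q - (k + 1)) \<le> b" using k \<open>k < q\<close> by simp
    ultimately have ex: "\<exists>p'. Inv p' s2 \<and> Suc (Suc (Suc p')) \<le> b" by auto
    show "run (Seq (iput c (IAdd e (reg 2)) (reg 2)) (setreg 2 (IAdd (reg 2) (IConst 1)))) s1
      (\<lambda>t s'. \<exists>p'. Inv p' s' \<and> t + 1 + p' \<le> b)"
      apply (intro run_Seq run_iput)
      using ex cond[OF inv] k(1,3) c q by (elim disjE) (simp_all add: s2_def)
  qed
  show ?thesis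
    unfolding leaves_def
  proof (rule run_Seq, rule run_iput, rule run_mono[OF loop])
    show "Inv (3 * nat q) (s\<lparr>imem := (imem s)(adr 0 (ieval (IConst 2) s) := ieval (IConst 0) s)\<rparr>)"
      unfolding Inv_def using q c by (intro exI[of _ 0]) auto
    fix t s' assume "\<exists>b. Inv b s' \<and> \<not> beval (ILess (reg 2) e) s' \<and> t + b \<le> 3 * nat q + 1"
    then obtain b where b: "Inv b s'" "\<not> beval (ILess (reg 2) e) s'" "t + b \<le> 3 * nat q + 1" by blast
    then have "q \<le> arr 0 (imem s') 2" using cond[OF b(1)] by simp
    then show "1 + t \<le> 3 * nat q + 2 \<and> rmem s' = rmem s \<and>
     (\<forall>k. k \<noteq> 2 \<longrightarrow> arr 0 (imem s') k = arr 0 (imem s) k) \<and>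
     (\<forall>c'\<in>{1,2,3,4} - {c}. arr c' (imem s') = arr c' (imem s)) \<and>
     arr c (imem s') = (\<lambda>u. if q \<le> u \<and> u < 2 * q then u - q else arr c (imem s) u)"
      using b(1,3) unfolding Inv_def by auto
  qed
qed

section \<open>Initialisation and output phases\<close>

definition init_jobs :: com where
  "init_jobs = Seq (leaves 3 regN) (Seq (setreg 1 (ISub regN (IConst 1))) (Seq (build pull_job)
     (rput 0 (IConst 1) (rget 4 (iget 3 (IConst 1))))))"

definition init_machines :: com where
  "init_machines = Seq (leaves 2 regM) (Seq (setreg 1 (ISub regM (IConst 1))) (Seq (build pull_machine)
     (setreg 2 (IConst 0))))"

definition find_makespan :: com where
  "find_makespan =
     Seq (rput 0 (IConst 0) (RConst 0)) (Seq (setreg 2 (IConst 0)) (While (ILess (reg 2) regM)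
       (Seq (If (RLess (rget 0 (IConst 0)) (rget 1 (reg 2))) (rput 0 (IConst 0) (rget 1 (reg 2))) Skip)
         (setreg 2 (IAdd (reg 2) (IConst 1))))))"

definition lpt_program :: com where
  "lpt_program = Seq init_jobs (Seq init_machines (Seq (While (ILess (reg 2) regN) schedule_job) find_makespan))"

text \<open>The current size starts at the largest job size, above every later query; the machine
  tree is then built for it.\<close>

lemma run_init_jobs:
  assumes mem: "mem_ok n m v s" and n: "1 \<le> n" and J: "arr 3 (imem s) = (\<lambda>_. 0)"
  shows "run init_jobs s (\<lambda>t s'. t \<le> 7 * nat n + 5 \<and> mem_ok n m v s' \<and> job_tree n s' \<and>
     arr 0 (rmem s') 1 = arr 4 (rmem s) (arr 3 (imem s') 1) \<and> arr 2 (imem s') = arr 2 (imem s) \<and>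
     (\<forall>c\<in>{1,2,4}. arr c (rmem s') = arr c (rmem s)))"
proof -
  have n0: "arr 0 (imem s) 0 = n" using mem by (simp add: mem_ok_def)
  show ?thesis
    unfolding init_jobs_def
  proof (rule run_Seq, rule run_mono[OF run_leaves[of s regN n 3]], goal_cases)
    case (4 t1 s1)
    define s2 where "s2 = s1\<lparr>imem := (imem s1)(adr 0 1 := n - 1)\<rparr>"
    have n1: "arr 0 (imem s1) 0 = n" using 4 n0 by simp
    have J1: "arr 3 (imem s1) = (\<lambda>u. if n \<le> u \<and> u < 2 * n then u - n else 0)" using 4 unfolding J by simp
    have s2: "arr 0 (imem s2) 1 = n - 1" "rmem s2 = rmem s"
      "arr 3 (imem s2) = (\<lambda>u. if n \<le> u \<and> u < 2 * n then u - n else 0)"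
      "arr 2 (imem s2) = arr 2 (imem s)" "arr 1 (imem s2) = arr 1 (imem s)" "arr 0 (imem s2) 0 = n"
      using 4 J1 n1 by (simp_all add: s2_def)
    show ?case
      apply (rule run_Seq, rule run_iput, rule run_Seq)
      apply (rule run_mono[where Q = "\<lambda>t s'. t \<le> 4 * nat (n - 1) + 1 \<and> same_but_jobs s2 s' \<and>
     (\<forall>q\<in>{1..n - 1}. pulled (\<lambda>i. - arr 4 (rmem s2) i) (\<lambda>_. 1) 0 (arr 3 (imem s')) (\<lambda>_. 0) q) \<and>
     (\<forall>q. q \<notin> {1..n - 1} \<longrightarrow> arr 3 (imem s') q = arr 3 (imem s2) q)"])
      \<comment> \<open>Zeros in the inner nodes are valid job indices, so the range condition of
        the build holds before these nodes are computed.\<close>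
      subgoal
        using run_build_job[of n s2 "n - 1"] s2(1,3) n n1 by (simp add: s2_def)
      subgoal premises p for t3 s3
      proof (rule run_rput)
        let ?s4 = "s3\<lparr>rmem := (rmem s3)(adr 0 (ieval (IConst 1) s3) := reval (rget 4 (iget 3 (IConst 1))) s3)\<rparr>"
        have r3: "rmem s3 = rmem s" using p s2 by (simp add: same_but_jobs_def)
        have leaf: "arr 3 (imem s3) (n + j) = j" if "0 \<le> j" "j < n" for j
          using p that s2(3) by simp
        have jt: "job_tree n s3"
          unfolding job_tree_def tree_ok_def r3
          using leaf p pulled_node_ok s2(2) by fastforce
        have "0 \<le> arr 3 (imem s3) 1" using job_tree_root(1)[OF jt n] .
        then have r4: "arr 0 (rmem ?s4) 1 = arr 4 (rmem s) (arr 3 (imem s3) 1)"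
          "\<And>c. c \<in> {1,2,4} \<Longrightarrow> arr c (rmem ?s4) = arr c (rmem s)"
          by (auto simp: r3)
        have "job_tree n ?s4" by (rule job_tree_cong[OF jt]) (simp_all add: r4 r3)
        moreover have "mem_ok n m v ?s4" using mem p s2 by (simp add: mem_ok_def same_but_jobs_def r3)
        moreover have "arr 2 (imem ?s4) = arr 2 (imem s)" using p s2 by (simp add: same_but_jobs_def)
        moreover have "t1 + (1 + (t3 + 1)) \<le> 7 * nat n + 5" using p 4 n by auto
        ultimately show "t1 + (1 + (t3 + 1)) \<le> 7 * nat n + 5 \<and> mem_ok n m v ?s4 \<and> job_tree n ?s4 \<and>
          arr 0 (rmem ?s4) 1 = arr 4 (rmem s) (arr 3 (imem ?s4) 1) \<and> arr 2 (imem ?s4) = arr 2 (imem s) \<and>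
          (\<forall>c\<in>{1,2,4}. arr c (rmem ?s4) = arr c (rmem s))"
          using r4 by simp
      qed
      done
  qed (use n n0 in auto)
qed

context speeds
begin

lemma run_init_machines:
  assumes mem: "mem_ok n m v s" and W: "arr 2 (imem s) = (\<lambda>_. 0)" and H: "arr 2 (rmem s) = (\<lambda>_. 0)"
  shows "run init_machines s (\<lambda>t s'. t \<le> 15 * nat m + 5 \<and> mem_ok n m v s' \<and>
     machine_tree m v s' (arr 0 (rmem s) 1) \<and> arr 3 (imem s') = arr 3 (imem s) \<and> arr 0 (imem s') 2 = 0 \<and>
     (\<forall>c\<in>{0,1,4}. arr c (rmem s') = arr c (rmem s)))"
proof -
  have m0: "arr 1 (imem s) 0 = m" using mem by (simp add: mem_ok_def)
  show ?thesis
    unfolding init_machines_def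
  proof (rule run_Seq, rule run_mono[OF run_leaves[of s regM m 2]], goal_cases)
    case (4 t1 s1)
    define s2 where "s2 = s1\<lparr>imem := (imem s1)(adr 0 1 := m - 1)\<rparr>"
    have m1: "arr 1 (imem s1) 0 = m" using 4 m0 by simp
    have W1: "arr 2 (imem s1) = (\<lambda>u. if m \<le> u \<and> u < 2 * m then u - m else 0)" using 4 unfolding W by simp
    have s2: "arr 0 (imem s2) 1 = m - 1" "rmem s2 = rmem s"
      "arr 2 (imem s2) = (\<lambda>u. if m \<le> u \<and> u < 2 * m then u - m else 0)"
      "arr 3 (imem s2) = arr 3 (imem s)" "arr 1 (imem s2) = arr 1 (imem s)" "arr 0 (imem s2) 0 = arr 0 (imem s) 0"
      using 4 W1 m1 by (simp_all add: s2_def)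
    have mem2: "mem_ok n m v s2" using mem s2 by (simp add: mem_ok_def)
    show ?case
      apply (rule run_Seq, rule run_iput, rule run_Seq)
      apply (rule run_mono[where Q = "\<lambda>t s'. t \<le> 12 * nat (m - 1) + 1 \<and> same_but_machines s2 s' \<and>
     (\<forall>q\<in>{1..m - 1}. pulled (arr 1 (rmem s2)) v (arr 0 (rmem s2) 1) (arr 2 (imem s')) (arr 2 (rmem s')) q) \<and>
     (\<forall>q. q \<notin> {1..m - 1} \<longrightarrow> arr 2 (imem s') q = arr 2 (imem s2) q \<and> arr 2 (rmem s') q = arr 2 (rmem s2) q)"])
      subgoal
        using run_build_machine[OF mem2, of "m - 1"] s2(1,3) m_pos m1 by (simp add: s2_def)
      subgoal premises p for t3 s3
      proof (rule run_iput)
        let ?s4 = "s3\<lparr>imem := (imem s3)(adr 0 (ieval (IConst 2) s3) := ieval (IConst 0) s3)\<rparr>"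
        have leaf: "arr 2 (imem s3) (m + j) = j \<and> arr 2 (rmem s3) (m + j) = 0" if "0 \<le> j" "j < m" for j
          using p that s2(2,3) H by simp
        have r3: "\<And>c. c \<in> {0,1,4} \<Longrightarrow> arr c (rmem s3) = arr c (rmem s)"
          using p s2 by (auto simp: same_but_machines_def)
        have node: "node_ok (arr 1 (rmem s)) v (arr 0 (rmem s) 1) (arr 2 (imem s3)) (arr 2 (rmem s3)) q"
          if "1 \<le> q" "q < m" for q
          using p that s2(2) by (intro pulled_node_ok) simp
        have "machine_tree m v s3 (arr 0 (rmem s) 1)"
          using leaf node r3 by (simp add: tree_ok_def)
        then have "machine_tree m v ?s4 (arr 0 (rmem s) 1)" by simp
        moreover have "mem_ok n m v ?s4" using mem2 p by (simp add: mem_ok_def same_but_machines_def)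
        moreover have "arr 3 (imem ?s4) = arr 3 (imem s)" using p s2 by (simp add: same_but_machines_def)
        moreover have "t1 + (1 + (t3 + 1)) \<le> 15 * nat m + 5" using p 4 m_pos by auto
        moreover have "arr 0 (imem ?s4) 2 = 0" by simp
        moreover have "\<forall>c\<in>{0,1,4}. arr c (rmem ?s4) = arr c (rmem s)" using r3 by simp
        ultimately show "t1 + (1 + (t3 + 1)) \<le> 15 * nat m + 5 \<and> mem_ok n m v ?s4 \<and>
           machine_tree m v ?s4 (arr 0 (rmem s) 1) \<and> arr 3 (imem ?s4) = arr 3 (imem s) \<and> arr 0 (imem ?s4) 2 = 0 \<and>
           (\<forall>c\<in>{0,1,4}. arr c (rmem ?s4) = arr c (rmem s))"
          by blast
      qed
      done
  qed (use m_pos m0 in auto)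
qed

end

text \<open>The maximum may start at 0 because loads are nonnegative and there is at least one
  machine.\<close>

lemma run_find_makespan:
  assumes m: "arr 1 (imem s) 0 = int m" "1 \<le> m" and T: "\<And>j. j < m \<Longrightarrow> arr 1 (rmem s) (int j) = T j \<and> 0 \<le> T j"
  shows "run find_makespan s (\<lambda>t s'. t \<le> 5 * m + 3 \<and> arr 4 (imem s') = arr 4 (imem s) \<and>
    arr 0 (rmem s') 0 = Max (T ` {..<m}))"
proof -
  define Inv where "Inv b s' \<longleftrightarrow> (\<exists>k r. k \<le> m \<and> arr 0 (imem s') 2 = int k \<and> arr 1 (imem s') 0 = int m \<and>
     arr 1 (rmem s') = arr 1 (rmem s) \<and> arr 4 (imem s') = arr 4 (imem s) \<and> b = 5 * (m - k) \<and>
     arr 0 (rmem s') 0 = r \<and> (\<forall>j<k. T j \<le> r) \<and> (r = 0 \<or> (\<exists>j<k. r = T j)))" for b and s' :: state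
  let ?body = "Seq (If (RLess (rget 0 (IConst 0)) (rget 1 (reg 2))) (rput 0 (IConst 0) (rget 1 (reg 2))) Skip)
         (setreg 2 (IAdd (reg 2) (IConst 1)))"
  have loop: "run (While (ILess (reg 2) regM) ?body) s0
     (\<lambda>t s'. \<exists>b. Inv b s' \<and> \<not> beval (ILess (reg 2) regM) s' \<and> t + b \<le> 5 * m + 1)" if "Inv (5 * m) s0" for s0
  proof (rule run_While[where I = Inv, OF that])
    fix b s1 assume inv: "Inv b s1" and bev: "beval (ILess (reg 2) regM) s1"
    then obtain k r where k: "k \<le> m" "arr 0 (imem s1) 2 = int k" "arr 1 (imem s1) 0 = int m"
     "arr 1 (rmem s1) = arr 1 (rmem s)" "arr 4 (imem s1) = arr 4 (imem s)" "b = 5 * (m - k)"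
     "arr 0 (rmem s1) 0 = r" and r: "\<forall>j<k. T j \<le> r" "r = 0 \<or> (\<exists>j<k. r = T j)" unfolding Inv_def by blast
    have km: "k < m" using bev k by simp
    have Tk: "arr 1 (rmem s) (int k) = T k" using T[OF km] by simp
    define r' where "r' = max r (T k)"
    have r': "\<forall>j<Suc k. T j \<le> r'" "r' = 0 \<or> (\<exists>j<Suc k. r' = T j)"
      using r by (auto simp: r'_def less_Suc_eq max_def)
    have I: "\<exists>p'. Inv p' s' \<and> Suc (Suc (Suc (Suc p'))) \<le> b" if "arr 0 (imem s') 2 = int (Suc k)" "arr 1 (imem s') 0 = int m"
     "arr 1 (rmem s') = arr 1 (rmem s)" "arr 4 (imem s') = arr 4 (imem s)" "arr 0 (rmem s') 0 = r'" for s'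
      unfolding Inv_def using that km k(6) r' by (intro exI[of _ "5 * (m - Suc k)"] conjI exI[of _ "Suc k"] exI[of _ r']) auto
    show "run ?body s1 (\<lambda>t s'. \<exists>p'. Inv p' s' \<and> t + 1 + p' \<le> b)"
      apply (intro run_basic)
      subgoal
        using I[of "s1\<lparr>rmem := (rmem s1)(adr 0 0 := T k), imem := (imem s1)(adr 0 2 := int k + 1)\<rparr>"] k Tk
        by (simp add: r'_def max_def)
      subgoal
        using I[of "s1\<lparr>imem := (imem s1)(adr 0 2 := int k + 1)\<rparr>"] k Tk
        by (simp add: r'_def max_def)
      done
  qed
  show ?thesis
    unfolding find_makespan_def
  proof (rule run_Seq, rule run_rput, rule run_Seq, rule run_iput, rule run_mono[OF loop], goal_cases)
    case 1
    then show ?case unfolding Inv_def using m by (intro exI[of _ 0]) auto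
  next
    case (2 t s')
    then obtain b where b: "Inv b s'" and t: "\<not> beval (ILess (reg 2) regM) s'" "t \<le> 5 * m + 1" by auto
    then obtain k r where k: "k \<le> m" "arr 0 (imem s') 2 = int k" "arr 1 (imem s') 0 = int m"
     "arr 4 (imem s') = arr 4 (imem s)" "arr 0 (rmem s') 0 = r" and r: "\<forall>j<k. T j \<le> r" "r = 0 \<or> (\<exists>j<k. r = T j)"
      unfolding Inv_def by blast
    have km: "k = m" using t k by simp
    have "r \<in> T ` {..<m}"
    \<comment> \<open>If the start value 0 survives, all loads are 0, so it is still attained,
      namely by machine 0.\<close>
    proof (cases "r = 0")
      case True
      then have "T 0 = r" using r(1) T[of 0] m km by fastforce
      then show ?thesis using m by force
    qed (use r km in auto)
    then have "Max (T ` {..<m}) = r" using r(1) km by (intro Max_eqI) auto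
    then show ?case using k t by simp
  qed
qed

lemma (in speeds) budget_le: "budget s \<le> nat m * blen (2 * m) * (15 * blen (2 * m) + 6)"
proof -
  have "event_cost m + 1 = 15 * blen (2 * m) + 6" by simp
  then show ?thesis unfolding budget_def by (simp only: mult_le_mono1[OF card_bad])
qed

section \<open>The loop invariant and the complete run\<close>

definition sched :: "state \<Rightarrow> nat \<Rightarrow> nat" where
  "sched s i = nat (arr 4 (imem s) (int i))"

lemma sched_eq: "output_schedule s = sched s"
  by (simp add: fun_eq_iff sched_def output_schedule_def arr_def adr_def)

text \<open>The current size separates scheduled jobs from remaining ones. This yields the sorted
  order of \<open>\<pi>\<close> and ensures that the next size does not exceed the size at which the
  machine tree is valid. The last conjunct is kept because \<open>sched\<close> truncates negative
  entries.\<close>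

definition lpt_inv :: "nat \<Rightarrow> nat \<Rightarrow> (nat \<Rightarrow> real) \<Rightarrow> (nat \<Rightarrow> real) \<Rightarrow> nat \<Rightarrow> (nat \<Rightarrow> nat) \<Rightarrow> state \<Rightarrow> bool" where
  "lpt_inv n m l v k \<pi> s \<longleftrightarrow>
     mem_ok (int n) (int m) (\<lambda>j. v (nat j)) s \<and> job_tree (int n) s \<and>
     machine_tree (int m) (\<lambda>j. v (nat j)) s (arr 0 (rmem s) 1) \<and>
     arr 0 (imem s) 2 = int k \<and> partial_LPT n m l v \<pi> (sched s) k \<and>
     (\<forall>i<n. arr 4 (rmem s) (int i) = (if i \<in> \<pi> ` {..<k} then 0 else l i)) \<and>
     (\<forall>b<k. arr 0 (rmem s) 1 \<le> l (\<pi> b)) \<and> (\<forall>i<n. i \<notin> \<pi> ` {..<k} \<longrightarrow> l i \<le> arr 0 (rmem s) 1) \<and>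
     (\<forall>j<m. arr 1 (rmem s) (int j) = lpt_load l v \<pi> (sched s) k j) \<and>
     (\<forall>b<k. 0 \<le> arr 4 (imem s) (int (\<pi> b)))"

lemma lpt_inv_step:
  assumes inv: "lpt_inv n m l v k \<pi> s" and k: "k < n" and m: "1 \<le> m"
    and l: "\<And>i. i < n \<Longrightarrow> 0 < l i" and v: "\<And>j. j < m \<Longrightarrow> 0 < v j"
  shows "run schedule_job s (\<lambda>t s'.
    t + speeds.budget (int m) (\<lambda>j. v (nat j)) s' \<le> speeds.budget (int m) (\<lambda>j. v (nat j)) s + speeds.job_cost (int m) (int n) \<and>
    (\<exists>\<pi>'. lpt_inv n m l v (Suc k) \<pi>' s'))"
proof -
  define V where "V = (\<lambda>j. v (nat j))"
  interpret speeds "int m" V using m v by unfold_locales (auto simp: V_def)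
  let ?K = "arr 4 (rmem s)" and ?T = "arr 1 (rmem s)" and ?y = "arr 0 (rmem s) 1"
  have I: "mem_ok (int n) (int m) V s" "job_tree (int n) s" "machine_tree (int m) V s ?y"
     "arr 0 (imem s) 2 = int k" "partial_LPT n m l v \<pi> (sched s) k"
     "\<And>i. i < n \<Longrightarrow> ?K (int i) = (if i \<in> \<pi> ` {..<k} then 0 else l i)"
     "\<And>b. b < k \<Longrightarrow> ?y \<le> l (\<pi> b)" "\<And>i. i < n \<Longrightarrow> i \<notin> \<pi> ` {..<k} \<Longrightarrow> l i \<le> ?y"
     "\<And>j. j < m \<Longrightarrow> ?T (int j) = lpt_load l v \<pi> (sched s) k j"
     "\<And>b. b < k \<Longrightarrow> 0 \<le> arr 4 (imem s) (int (\<pi> b))"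
    using inv unfolding lpt_inv_def V_def by blast+
  define i where "i = nat (arr 3 (imem s) 1)"
  have n: "1 \<le> int n" using k by simp
  note root = job_tree_root[OF I(2) n]
  have i: "arr 3 (imem s) 1 = int i" "i < n" using root(1,2) by (auto simp: i_def)
  \<comment> \<open>Some job is still unscheduled and has positive size, so the root's entry is
    positive and the root's job is unscheduled too.\<close>
  have "card (\<pi> ` {..<k}) < card {..<n}"
    using card_image_le[of "{..<k}" \<pi>] k by simp
  then have "\<not> {..<n} \<subseteq> \<pi> ` {..<k}" using card_mono[of "\<pi> ` {..<k}" "{..<n}"] by auto
  then obtain i' where i': "i' < n" "i' \<notin> \<pi> ` {..<k}" by auto
  have "0 < ?K (int i)" using root(3)[of "int i'"] i' I(6)[of i'] l[of i'] i(1) by simp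
  then have iu: "i \<notin> \<pi> ` {..<k}" "?K (int i) = l i" using I(6)[OF i(2)] by (auto split: if_splits)
  have x: "0 < l i" "l i \<le> ?y" using l i(2) I(8) iu by auto
  show ?thesis
    unfolding V_def[symmetric]
  proof (rule run_mono[OF run_schedule_job[OF I(1) n I(2,3) refl i(1) iu(2) x]], elim conjE exE, intro conjI)
    fix t s' j
    assume a: "mem_ok (int n) (int m) V s'" "job_tree (int n) s'" "machine_tree (int m) V s' (l i)" "arr 0 (rmem s') 1 = l i"
      "arr 0 (imem s') 2 = arr 0 (imem s) 2 + 1" "arr 4 (rmem s') = ?K(int i := 0)"
      and j: "0 \<le> j" "j < int m" "\<forall>k. 0 \<le> k \<longrightarrow> k < int m \<longrightarrow> finish ?T V (l i) j \<le> finish ?T V (l i) k"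
      and u: "arr 1 (rmem s') = ?T(j := ?T j + l i / V j)" "arr 4 (imem s') = (arr 4 (imem s))(int i := j)"
    define j' where "j' = nat j"
    have j': "j = int j'" "j' < m" using j by (auto simp: j'_def)
    have sc: "sched s' i = j'" "\<And>a. a \<noteq> i \<Longrightarrow> sched s' a = sched s a" using u(2) j' by (auto simp: sched_def)
    have min: "lpt_load l v \<pi> (sched s) k j' + l i / v j' \<le> lpt_load l v \<pi> (sched s) k q + l i / v q" if "q < m" for q
      using j(3)[rule_format, of "int q"] that I(9)[OF j'(2)] I(9)[OF that] by (simp add: finish_def V_def j')
    have le: "l i \<le> l (\<pi> b)" if "b < k" for b using I(7)[OF that] x by simp
    note st = partial_LPT_step[OF I(5) i(2) iu(1) le j'(2) min sc]
    have img: "(\<pi>(k := i)) ` {..<Suc k} = insert i (\<pi> ` {..<k})" by (auto simp: lessThan_Suc)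
    have y': "arr 0 (rmem s') 1 = l i" by fact
    have "lpt_inv n m l v (Suc k) (\<pi>(k := i)) s'"
      unfolding lpt_inv_def img y' V_def[symmetric]
    proof (intro conjI allI impI a st)
      show "arr 0 (imem s') 2 = int (Suc k)" using a I(4) by simp
      show "arr 4 (rmem s') (int q) = (if q \<in> insert i (\<pi> ` {..<k}) then 0 else l q)" if "q < n" for q
        using I(6)[OF that] by (simp add: a(6))
      show "l i \<le> l ((\<pi>(k := i)) b)" if "b < Suc k" for b using le[of b] that by (cases "b = k") auto
      show "l q \<le> l i" if "q < n" "q \<notin> insert i (\<pi> ` {..<k})" for q
        using root(3)[of "int q"] I(6)[OF that(1)] that iu i(1) by simp
      show "arr 1 (rmem s') (int q) = lpt_load l v (\<pi>(k := i)) (sched s') (Suc k) q" if "q < m" for q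
        using I(9)[OF that] by (cases "q = j'") (simp_all add: st(2) u(1) j' V_def)
      show "0 \<le> arr 4 (imem s') (int ((\<pi>(k := i)) b))" if "b < Suc k" for b
        using I(10)[of b] that j(1) by (cases "b = k") (auto simp: u(2))
    qed
    then show "\<exists>\<pi>'. lpt_inv n m l v (Suc k) \<pi>' s'" by blast
  qed
qed

text \<open>The linear part adds \<open>7 * n + 5\<close> and \<open>15 * m + 5\<close> for the two
  initialisations, \<open>5 * m + 3\<close> for the makespan and 1 for the last loop test. The next
  summand bounds the initial budget for flips.\<close>

lemma run_lpt_program:
  assumes n: "1 \<le> n" and m: "1 \<le> m"
    and l: "\<And>i. i < n \<Longrightarrow> 0 < l i" and v: "\<And>j. j < m \<Longrightarrow> 0 < v j"
  shows "run lpt_program (init_state n m l v) (\<lambda>t s'. output_ok n m l v s' \<and>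
     t \<le> 7 * n + 20 * m + 14 + m * blen (2 * int m) * (15 * blen (2 * int m) + 6) +
       n * (speeds.job_cost (int m) (int n) + 1))"
proof -
  define V where "V = (\<lambda>j. v (nat j))"
  interpret speeds "int m" V using m v by unfold_locales (auto simp: V_def)
  let ?s = "init_state n m l v"
  have s0: "mem_ok (int n) (int m) V ?s" "arr 3 (imem ?s) = (\<lambda>_. 0)" "arr 2 (imem ?s) = (\<lambda>_. 0)"
    "arr 2 (rmem ?s) = (\<lambda>_. 0)" "arr 1 (rmem ?s) = (\<lambda>_. 0)" "\<And>i. i < n \<Longrightarrow> arr 4 (rmem ?s) (int i) = l i"
    by (auto simp: mem_ok_def arr_def adr_def init_state_def V_def fun_eq_iff nat_add_distrib)
  define P where "P t s' \<longleftrightarrow> output_ok n m l v s' \<and>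
     t \<le> 7 * n + 20 * m + 14 + m * blen (2 * int m) * (15 * blen (2 * int m) + 6) + n * (job_cost (int n) + 1)" for t and s' :: state
  define Inv where "Inv b s \<longleftrightarrow> (\<exists>k \<pi>. lpt_inv n m l v k \<pi> s \<and> b = budget s + (n - k) * (job_cost (int n) + 1))" for b and s :: state
  have finish: "run find_makespan s' (\<lambda>t4. P (t1 + (t2 + (t3 + t4))))"
    if t: "t1 \<le> 7 * n + 5" "t2 \<le> 15 * m + 5" "t3 \<le> budget s2 + n * (job_cost (int n) + 1) + 1"
      and inv: "lpt_inv n m l v n \<pi> s'" for t1 t2 t3 s2 s' \<pi>
  proof -
    have I: "mem_ok (int n) (int m) V s'" "partial_LPT n m l v \<pi> (sched s') n"
       "\<And>j. j < m \<Longrightarrow> arr 1 (rmem s') (int j) = lpt_load l v \<pi> (sched s') n j"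
       "\<And>b. b < n \<Longrightarrow> 0 \<le> arr 4 (imem s') (int (\<pi> b))"
      using inv unfolding lpt_inv_def V_def by blast+
    note c = partial_LPT_complete[OF I(2)]
    have "\<pi> ` {..<n} = {..<n}" using I(2) unfolding partial_LPT_def by (intro endo_inj_surj) blast+
    have nonneg: "0 \<le> arr 4 (imem s') (int i)" if "i < n" for i
    proof -
      have "i \<in> \<pi> ` {..<n}" using \<open>\<pi> ` {..<n} = {..<n}\<close> that by simp
      then show ?thesis using I(4) by auto
    qed
    have T: "arr 1 (rmem s') (int j) = completion_time n l v (sched s') j \<and> 0 \<le> completion_time n l v (sched s') j" if "j < m" for j
      using I(3)[OF that] c(2) l v[OF that] unfolding completion_time_def by (auto intro!: sum_nonneg divide_nonneg_pos simp: less_imp_le)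
    have m0: "arr 1 (imem s') 0 = int m" using I(1) by (simp add: mem_ok_def)
    show ?thesis
    proof (rule run_mono[OF run_find_makespan[OF m0 m T]])
      fix t4 :: nat and s4 :: state
      assume a: "t4 \<le> 5 * m + 3 \<and> arr 4 (imem s4) = arr 4 (imem s') \<and>
        arr 0 (rmem s4) 0 = Max (completion_time n l v (sched s') ` {..<m})"
      have sc: "sched s4 = sched s'" using a by (simp add: sched_def fun_eq_iff)
      have "rmem s4 (-1) = arr 0 (rmem s4) 0" by (simp add: arr_def adr_def)
      moreover have "0 \<le> imem s4 (int i)" if "i < n" for i
      proof -
        have "imem s4 (int i) = arr 4 (imem s4) (int i)" by (simp add: arr_def adr_def)
        then show ?thesis using nonneg[OF that] a by simp
      qed
      ultimately have "output_ok n m l v s4"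
        using c(1) a unfolding output_ok_def sched_eq sc makespan_def by simp
      moreover have "budget s2 \<le> m * blen (2 * int m) * (15 * blen (2 * int m) + 6)"
        using budget_le[of s2] by simp
      ultimately show "P (t1 + (t2 + (t3 + t4))) s4" using t a unfolding P_def by linarith
    qed
  qed
  have "run lpt_program ?s P"
    unfolding lpt_program_def
  proof (rule run_Seq, rule run_mono[OF run_init_jobs[OF s0(1) _ s0(2)]], goal_cases)
    case 1
    then show ?case using n by simp
  next
    case (2 t1 s1)
    then have s1: "t1 \<le> 7 * n + 5" "mem_ok (int n) (int m) V s1" "job_tree (int n) s1"
      "arr 0 (rmem s1) 1 = arr 4 (rmem ?s) (arr 3 (imem s1) 1)" "arr 2 (imem s1) = (\<lambda>_. 0)"
      "arr 1 (rmem s1) = (\<lambda>_. 0)" "arr 2 (rmem s1) = (\<lambda>_. 0)" "arr 4 (rmem s1) = arr 4 (rmem ?s)" using s0 by auto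
    show ?case
    proof (rule run_Seq, rule run_mono[OF run_init_machines[OF s1(2,5,7)]], goal_cases)
      case (1 t2 s2)
      then have s2: "t2 \<le> 15 * m + 5" "mem_ok (int n) (int m) V s2" "machine_tree (int m) V s2 (arr 0 (rmem s2) 1)"
        "arr 3 (imem s2) = arr 3 (imem s1)" "arr 0 (imem s2) 2 = 0" "arr 0 (rmem s2) 1 = arr 0 (rmem s1) 1"
        "arr 1 (rmem s2) = arr 1 (rmem s1)" "arr 4 (rmem s2) = arr 4 (rmem s1)" by auto
      have jt: "job_tree (int n) s2" by (rule job_tree_cong[OF s1(3) s2(4,8)])
      have "l i \<le> arr 0 (rmem s2) 1" if "i < n" for i
        using job_tree_root(3)[OF jt _, of "int i"] that s0(6)[OF that] s1 s2 by simp
      \<comment> \<open>Before the first job any function represents the empty processing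
        order.\<close>
      then have inv0: "lpt_inv n m l v 0 (\<lambda>_. 0) s2"
        unfolding lpt_inv_def partial_LPT_def using s1 s2 s0(6) jt by (simp add: V_def[symmetric] lpt_load_def)
      have "run (While (ILess (reg 2) regN) schedule_job) s2 (\<lambda>t s'. \<exists>b. Inv b s' \<and>
        \<not> beval (ILess (reg 2) regN) s' \<and> t + b \<le> budget s2 + n * (job_cost (int n) + 1) + 1)"
      proof (rule run_While)
        show "Inv (budget s2 + n * (job_cost (int n) + 1)) s2" unfolding Inv_def using inv0 by fastforce
        fix b s assume "Inv b s" and bev: "beval (ILess (reg 2) regN) s"
        then obtain k \<pi> where k: "lpt_inv n m l v k \<pi> s" "b = budget s + (n - k) * (job_cost (int n) + 1)" unfolding Inv_def by blast
        have kn: "k < n" using bev k(1) unfolding lpt_inv_def mem_ok_def by simp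
        show "run schedule_job s (\<lambda>t s'. \<exists>p'. Inv p' s' \<and> t + 1 + p' \<le> b)"
        proof (rule run_mono[OF lpt_inv_step[OF k(1) kn m l v, folded V_def]])
          fix t s' assume a: "t + budget s' \<le> budget s + job_cost (int n) \<and> (\<exists>\<pi>'. lpt_inv n m l v (Suc k) \<pi>' s')"
          have "(n - k) * (job_cost (int n) + 1) = (n - Suc k) * (job_cost (int n) + 1) + job_cost (int n) + 1"
            using Suc_diff_Suc[OF kn] by (metis add.assoc add.commute mult_Suc)
          then have "t + 1 + (budget s' + (n - Suc k) * (job_cost (int n) + 1)) \<le> b" using a unfolding k(2) by linarith
          then show "\<exists>p'. Inv p' s' \<and> t + 1 + p' \<le> b" using a unfolding Inv_def by blast
        qed
      qed
      then show ?case
      proof (intro run_Seq, elim run_mono)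
        fix t3 s' assume "\<exists>b. Inv b s' \<and> \<not> beval (ILess (reg 2) regN) s' \<and> t3 + b \<le> budget s2 + n * (job_cost (int n) + 1) + 1"
        then obtain k \<pi> where k: "lpt_inv n m l v k \<pi> s'" and t3: "t3 \<le> budget s2 + n * (job_cost (int n) + 1) + 1"
          and bev: "\<not> beval (ILess (reg 2) regN) s'" unfolding Inv_def by auto
        have "k = n" using bev k unfolding lpt_inv_def mem_ok_def partial_LPT_def by simp
        then show "run find_makespan s' (\<lambda>t4. P (t1 + (t2 + (t3 + t4))))"
          using finish[OF s1(1) s2(1) t3] k by blast
      qed
    qed
  qed
  then show ?thesis by (simp add: P_def[abs_def])
qed

section \<open>From operation counts to the asymptotic bound\<close>

lemma lpt_cost_bound:
  assumes n: "1 \<le> n" and m: "1 \<le> m"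
    and t: "t \<le> 7 * n + 20 * m + 14 + m * a * (15 * a + 6) + n * (4 * b + 12 * a + 13 + a * (15 * a + 6) + 1)"
    and a: "real a \<le> log 2 (real m) + 2" and b: "real b \<le> log 2 (real n) + 2"
  shows "real t \<le> 400 * (real n + real m) * ((log 2 (real m))\<^sup>2 + log 2 (real n) + 1)"
proof -
  define L where "L = log 2 (real m)"
  \<comment> \<open>\<open>R\<close> bounds the cost per job or machine. Its constant 48 is 14 from
    the job cost plus 34, which absorbs the linear part because \<open>n\<close> and
    \<open>m\<close> are at least 1.\<close>
  define R where "R = 48 + 15 * (real a)\<^sup>2 + 18 * real a + 4 * real b"
  have L: "0 \<le> L" "0 \<le> log 2 (real n)" using n m by (simp_all add: L_def)
  have "real t \<le> real (7 * n + 20 * m + 14 + m * a * (15 * a + 6) + n * (4 * b + 12 * a + 13 + a * (15 * a + 6) + 1))"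
    using t by (simp only: of_nat_le_iff)
  also have "\<dots> \<le> real n * R + real m * R"
  proof -
    have "real (m * a * (15 * a + 6)) + 34 * real m \<le> real m * R"
      by (simp add: R_def power2_eq_square algebra_simps)
    moreover have "real (n * (4 * b + 12 * a + 13 + a * (15 * a + 6) + 1)) + 34 * real n \<le> real n * R"
      by (simp add: R_def power2_eq_square algebra_simps)
    ultimately show ?thesis using n m by simp
  qed
  also have "\<dots> = (real n + real m) * R" by (simp add: algebra_simps)
  also have "\<dots> \<le> (real n + real m) * (400 * (L\<^sup>2 + log 2 (real n) + 1))"
  proof (rule mult_left_mono)
    have "(real a)\<^sup>2 \<le> (L + 2)\<^sup>2" using a by (intro power_mono) (auto simp: L_def)
    also have "\<dots> \<le> 2 * L\<^sup>2 + 8" using zero_le_power2[of "L - 2"] by (simp add: power2_eq_square algebra_simps)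
    finally have sq: "(real a)\<^sup>2 \<le> 2 * L\<^sup>2 + 8" .
    \<comment> \<open>The linear term in \<open>a\<close> goes into the square, leaving
      \<open>24 * a^2\<close>; together with the bound on the square this gives
      \<open>257 + 48 * L^2 + 4 * log 2 n\<close>, well below the factor 400.\<close>
    have "18 * x \<le> 9 * x\<^sup>2 + 9" for x :: real
      using zero_le_power2[of "x - 1"] by (simp add: power2_eq_square algebra_simps)
    from this[of "real a"] have "R \<le> 48 + 24 * (real a)\<^sup>2 + 9 + 4 * (log 2 (real n) + 2)"
      using b by (simp add: R_def)
    then show "R \<le> 400 * (L\<^sup>2 + log 2 (real n) + 1)" using sq L zero_le_power2[of L] unfolding distrib_left by linarith
  qed simp
  finally show ?thesis unfolding L_def by (simp only: mult_ac)
qed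

text \<open>Program and constant are chosen before \<open>n\<close> and \<open>m\<close>. The
  summand 1 keeps the bound positive at \<open>n = m = 1\<close>, where both logarithms
  vanish.\<close>

theorem theorem1:
  "\<exists>(prog :: com) (C :: real). \<forall>n m (l :: nat \<Rightarrow> real) (v :: nat \<Rightarrow> real).
     n \<ge> 1 \<longrightarrow> m \<ge> 1 \<longrightarrow> (\<forall>i<n. l i > 0) \<longrightarrow> (\<forall>j<m. v j > 0) \<longrightarrow>
     (\<exists>t s'. exec prog (init_state n m l v) t s' \<and> output_ok n m l v s' \<and>
        real t \<le> C * (real n + real m) * ((log 2 (real m))\<^sup>2 + log 2 (real n) + 1))"
proof (intro exI[of _ lpt_program] exI[of _ "400 :: real"] allI impI)
  fix n m :: nat and l v :: "nat \<Rightarrow> real"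
  assume n: "1 \<le> n" and m: "1 \<le> m" and l: "\<forall>i<n. 0 < l i" and v: "\<forall>j<m. 0 < v j"
  interpret speeds "int m" "\<lambda>j. v (nat j)" using m v by unfold_locales auto
  obtain t s' where e: "exec lpt_program (init_state n m l v) t s'" "output_ok n m l v s'"
    and t: "t \<le> 7 * n + 20 * m + 14 + m * blen (2 * int m) * (15 * blen (2 * int m) + 6) + n * (job_cost (int n) + 1)"
    using run_lpt_program[OF n m] l v unfolding run_def by blast
  have cost: "job_cost (int n) = 4 * blen (2 * int n) + 12 * blen (2 * int m) + 13
      + blen (2 * int m) * (15 * blen (2 * int m) + 6)"
    by (simp add: job_cost_def algebra_simps)
  have log: "real (blen (2 * int q)) \<le> log 2 (real q) + 2" if "1 \<le> q" for q
    using blen_log[of "2 * q"] that by (simp add: log_mult)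
  have "real t \<le> 400 * (real n + real m) * ((log 2 (real m))\<^sup>2 + log 2 (real n) + 1)"
    by (rule lpt_cost_bound[OF n m t[unfolded cost] log[OF m] log[OF n]])
  then show "\<exists>t s'. exec lpt_program (init_state n m l v) t s' \<and> output_ok n m l v s' \<and>
        real t \<le> 400 * (real n + real m) * ((log 2 (real m))\<^sup>2 + log 2 (real n) + 1)"
    using e by blast
qed

end
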